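(* A homotopy equivalence between minimal ringed finite spaces is an isomorphism. In particular, the core of a ringed finite space is unique up to isomorphism, and two ringed finite spaces are homotopy equivalent if and only if they have isomorphic cores.
   Context: A ringed finite space is a ringed space (with a sheaf of commutative unital rings) whose underlying topological space is finite. For a point $p$, $U_p$ is the smallest open subset containing $p$; $p\leq q$ means $q\in U_p$, equivalently $p\in\bar q$ (closure of $q$); the stalk at $p$ is $\mathcal{O}_p=\mathcal{O}(U_p)$ and for $p\leq q$, $r_{pq}\colon\mathcal{O}_p\to\mathcal{O}_q$ is the restriction. A morphism of ringed spaces $f\colon X\to Y$ consists of a continuous map together with compatible ring homomorphisms $f^\#_x\colon\mathcal{O}_{f(x)}\to\mathcal{O}_x$, $x\in X$. Homotopy: for morphisms $f,g\colon X\to Y$ of ringed finite spaces, $f\leq g$ means that $f(x)\leq g(x)$ and $g^\#_x\circ r_{f(x)g(x)}=f^\#_x$ for all $x\in X$; $f\equiv g$ means $f\leq g$ or $g\leq f$; and $f\sim g$ (homotopic) means there is a finite sequence of morphisms $f=f_0\equiv f_1\equiv\cdots\equiv f_n=g$. A homotopy equivalence is a morphism $f\colon X\to Y$ for which there is a morphism $g\colon Y\to X$ with $g\circ f\sim\mathrm{Id}_X$ and $f\circ g\sim\mathrm{Id}_Y$; $X$ and $Y$ are then called homotopy equivalent. Strong deformation retract: a subspace $i\colon Z\hookrightarrow X$ (with sheaf of rings $\mathcal{O}_{X|Z}$) is a strong deformation retract of $X$ if there is a morphism $r\colon X\to Z$ with $r\circ i=\mathrm{Id}_Z$ and $i\circ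 r$ homotopic to $\mathrm{Id}_X$ relative to $Z$, i.e. through a sequence $i\circ r=f_0\equiv\cdots\equiv f_n=\mathrm{Id}_X$ with $f_j\circ i=i$ for all $j$. Beat points: let $X$ be a ringed finite space which is $T_0$ (i.e. $\leq$ is antisymmetric). A point $p$ is a down beat point if $\bar p-\{p\}$ has a maximum; it is an up beat point if $U_p-\{p\}$ has a minimum $q$ and $r_{pq}\colon\mathcal{O}_p\to\mathcal{O}_q$ is an isomorphism; it is a beat point if it is one of these. A minimal ringed finite space is a ringed finite $T_0$-space without beat points. A core of a ringed finite space $X$ is a strong deformation retract of $X$ which is a minimal ringed finite space. *)

theory Defs
  imports "HOL-Analysis.Abstract_Topological_Spaces" "HOL-Algebra.QuotRing"
begin

section \<open>Ringed spaces\<close>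

text \<open>
  \<open>sections X U\<close> is the ring \<open>\<O>\<^sub>X(U)\<close> and \<open>restr X U V\<close> the restriction
  \<open>\<O>\<^sub>X(U) \<rightarrow> \<O>\<^sub>X(V)\<close>. Both are meaningful only for open \<open>V \<subseteq> U\<close>.
\<close>

record ('a, 'r) ringed_space_data =
  top_of :: "'a topology"
  sections :: "'a set \<Rightarrow> 'r ring"
  restr :: "'a set \<Rightarrow> 'a set \<Rightarrow> 'r \<Rightarrow> 'r"

abbreviation points :: "('a, 'r) ringed_space_data \<Rightarrow> 'a set" where
  "points X \<equiv> topspace (top_of X)"

locale ringed_space =
  fixes X :: "('a, 'r) ringed_space_data"
  assumes cring_sections: "openin (top_of X) U \<Longrightarrow> cring (sections X U)"
    and restr_hom: "\<lbrakk>openin (top_of X) U; openin (top_of X) V; V \<subseteq> U\<rbrakk>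
          \<Longrightarrow> restr X U V \<in> ring_hom (sections X U) (sections X V)"
    and restr_id: "\<lbrakk>openin (top_of X) U; s \<in> carrier (sections X U)\<rbrakk> \<Longrightarrow> restr X U U s = s"
    and restr_restr: "\<lbrakk>openin (top_of X) U; openin (top_of X) V; openin (top_of X) W;
            W \<subseteq> V; V \<subseteq> U; s \<in> carrier (sections X U)\<rbrakk>
          \<Longrightarrow> restr X V W (restr X U V s) = restr X U W s"
    and locality: "\<lbrakk>\<And>V. V \<in> \<V> \<Longrightarrow> openin (top_of X) V;
            s \<in> carrier (sections X (\<Union>\<V>)); t \<in> carrier (sections X (\<Union>\<V>));
            \<And>V. V \<in> \<V> \<Longrightarrow> restr X (\<Union>\<V>) V s = restr X (\<Union>\<V>) V t\<rbrakk>
          \<Longrightarrow> s = t"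
    and gluing: "\<lbrakk>\<And>V. V \<in> \<V> \<Longrightarrow> openin (top_of X) V;
            \<And>V. V \<in> \<V> \<Longrightarrow> \<sigma> V \<in> carrier (sections X V);
            \<And>V W. \<lbrakk>V \<in> \<V>; W \<in> \<V>\<rbrakk>
              \<Longrightarrow> restr X V (V \<inter> W) (\<sigma> V) = restr X W (V \<inter> W) (\<sigma> W)\<rbrakk>
          \<Longrightarrow> \<exists>s \<in> carrier (sections X (\<Union>\<V>)). \<forall>V \<in> \<V>. restr X (\<Union>\<V>) V s = \<sigma> V"

locale ringed_finite_space = ringed_space X
  for X :: "('a, 'r) ringed_space_data" +
  assumes finite_points: "finite (points X)"

text \<open>In a finite space the intersection \<open>U\<^sub>p\<close> of all open neighbourhoods of \<open>p\<close> is open.\<close>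

definition min_open :: "('a, 'r) ringed_space_data \<Rightarrow> 'a \<Rightarrow> 'a set" where
  "min_open X p = \<Inter>{U. openin (top_of X) U \<and> p \<in> U}"

definition point_le :: "('a, 'r) ringed_space_data \<Rightarrow> 'a \<Rightarrow> 'a \<Rightarrow> bool" where
  "point_le X p q \<longleftrightarrow> p \<in> points X \<and> q \<in> min_open X p"

definition stalk :: "('a, 'r) ringed_space_data \<Rightarrow> 'a \<Rightarrow> 'r ring" where
  "stalk X p = sections X (min_open X p)"

definition stalk_restr :: "('a, 'r) ringed_space_data \<Rightarrow> 'a \<Rightarrow> 'a \<Rightarrow> 'r \<Rightarrow> 'r" where
  "stalk_restr X p q = restr X (min_open X p) (min_open X q)"


section \<open>Morphisms\<close>

text \<open>
  For a morphism \<open>f\<close> from \<open>X\<close> to \<open>Y\<close>, \<open>comor f x\<close> is \<open>f\<^sup>#\<^sub>x\<close>, a ring homomorphism from the stalk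
  of \<open>Y\<close> at \<open>f x\<close> to the stalk of \<open>X\<close> at \<open>x\<close>.
\<close>

record ('a, 'r, 'b, 's) rs_map =
  pt :: "'a \<Rightarrow> 'b"
  comor :: "'a \<Rightarrow> 's \<Rightarrow> 'r"

definition rs_morphism ::
  "('a, 'r) ringed_space_data \<Rightarrow> ('b, 's) ringed_space_data \<Rightarrow> ('a, 'r, 'b, 's) rs_map \<Rightarrow> bool"
where
  "rs_morphism X Y f \<longleftrightarrow>
     continuous_map (top_of X) (top_of Y) (pt f) \<and>
     (\<forall>x \<in> points X. comor f x \<in> ring_hom (stalk Y (pt f x)) (stalk X x)) \<and>
     (\<forall>x x'. point_le X x x' \<longrightarrow>
        (\<forall>s \<in> carrier (stalk Y (pt f x)).
           stalk_restr X x x' (comor f x s) =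
           comor f x' (stalk_restr Y (pt f x) (pt f x') s)))"

text \<open>
  HOL functions are total, so two representations denote the same morphism if they agree on the
  points of \<open>X\<close> and on the carriers of the stalks.
\<close>

definition rs_map_eq ::
  "('a, 'r) ringed_space_data \<Rightarrow> ('b, 's) ringed_space_data \<Rightarrow>
   ('a, 'r, 'b, 's) rs_map \<Rightarrow> ('a, 'r, 'b, 's) rs_map \<Rightarrow> bool"
where
  "rs_map_eq X Y f g \<longleftrightarrow>
     (\<forall>x \<in> points X. pt f x = pt g x \<and>
        (\<forall>s \<in> carrier (stalk Y (pt f x)). comor f x s = comor g x s))"

definition rs_id :: "('a, 'r, 'a, 'r) rs_map" where
  "rs_id = \<lparr>pt = \<lambda>x. x, comor = \<lambda>x s. s\<rparr>"

definition rs_comp ::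
  "('b, 's, 'c, 't) rs_map \<Rightarrow> ('a, 'r, 'b, 's) rs_map \<Rightarrow> ('a, 'r, 'c, 't) rs_map"
where
  "rs_comp g f = \<lparr>pt = \<lambda>x. pt g (pt f x), comor = \<lambda>x s. comor f x (comor g (pt f x) s)\<rparr>"

definition rs_isomorphism ::
  "('a, 'r) ringed_space_data \<Rightarrow> ('b, 's) ringed_space_data \<Rightarrow> ('a, 'r, 'b, 's) rs_map \<Rightarrow> bool"
where
  "rs_isomorphism X Y f \<longleftrightarrow> rs_morphism X Y f \<and>
     (\<exists>g. rs_morphism Y X g \<and>
        rs_map_eq X X (rs_comp g f) rs_id \<and> rs_map_eq Y Y (rs_comp f g) rs_id)"

definition rs_isomorphic ::
  "('a, 'r) ringed_space_data \<Rightarrow> ('b, 's) ringed_space_data \<Rightarrow> bool"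
where
  "rs_isomorphic X Y \<longleftrightarrow> (\<exists>f. rs_isomorphism X Y f)"


section \<open>Homotopy\<close>

definition rs_map_le ::
  "('a, 'r) ringed_space_data \<Rightarrow> ('b, 's) ringed_space_data \<Rightarrow>
   ('a, 'r, 'b, 's) rs_map \<Rightarrow> ('a, 'r, 'b, 's) rs_map \<Rightarrow> bool"
where
  "rs_map_le X Y f g \<longleftrightarrow>
     (\<forall>x \<in> points X. point_le Y (pt f x) (pt g x) \<and>
        (\<forall>s \<in> carrier (stalk Y (pt f x)).
           comor g x (stalk_restr Y (pt f x) (pt g x) s) = comor f x s))"

text \<open>
  Homotopy through morphisms satisfying \<open>P\<close>. Requiring the end points to be literally \<open>f\<close> and \<open>g\<close>
  is harmless, since maps related by \<^const>\<open>rs_map_eq\<close> are comparable for \<^const>\<open>rs_map_le\<close>.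
\<close>

definition rs_homotopic_with ::
  "(('a, 'r, 'b, 's) rs_map \<Rightarrow> bool) \<Rightarrow> ('a, 'r) ringed_space_data \<Rightarrow>
   ('b, 's) ringed_space_data \<Rightarrow> ('a, 'r, 'b, 's) rs_map \<Rightarrow> ('a, 'r, 'b, 's) rs_map \<Rightarrow> bool"
where
  "rs_homotopic_with P X Y f g \<longleftrightarrow>
     (\<exists>(F :: nat \<Rightarrow> ('a, 'r, 'b, 's) rs_map) n.
        F 0 = f \<and> F n = g \<and>
        (\<forall>j \<le> n. rs_morphism X Y (F j) \<and> P (F j)) \<and>
        (\<forall>j < n. rs_map_le X Y (F j) (F (Suc j)) \<or> rs_map_le X Y (F (Suc j)) (F j)))"

definition rs_homotopic ::
  "('a, 'r) ringed_space_data \<Rightarrow> ('b, 's) ringed_space_data \<Rightarrow>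
   ('a, 'r, 'b, 's) rs_map \<Rightarrow> ('a, 'r, 'b, 's) rs_map \<Rightarrow> bool"
where
  "rs_homotopic = rs_homotopic_with (\<lambda>_. True)"

definition rs_homotopy_equivalence ::
  "('a, 'r) ringed_space_data \<Rightarrow> ('b, 's) ringed_space_data \<Rightarrow> ('a, 'r, 'b, 's) rs_map \<Rightarrow> bool"
where
  "rs_homotopy_equivalence X Y f \<longleftrightarrow> rs_morphism X Y f \<and>
     (\<exists>g. rs_morphism Y X g \<and>
        rs_homotopic X X (rs_comp g f) rs_id \<and> rs_homotopic Y Y (rs_comp f g) rs_id)"

definition rs_homotopy_equivalent ::
  "('a, 'r) ringed_space_data \<Rightarrow> ('b, 's) ringed_space_data \<Rightarrow> bool"
where
  "rs_homotopy_equivalent X Y \<longleftrightarrow> (\<exists>f. rs_homotopy_equivalence X Y f)"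


section \<open>Subspaces and strong deformation retracts\<close>

text \<open>
  The sheaf \<open>\<O>\<^bsub>X|Z\<^esub>\<close> is the inverse image of \<open>\<O>\<^sub>X\<close> along the inclusion of \<open>Z\<close>: a section over \<open>V\<close>
  is a family of germs at the points of \<open>V\<close> which near each point of \<open>V\<close> comes from a section of
  \<open>\<O>\<^sub>X\<close>. The set \<open>Z\<close> is arbitrary (not necessarily open), so this is in general not
  \<open>\<O>\<^sub>X\<close> evaluated at open sets of \<open>X\<close>.
\<close>

definition sub_sections :: "('a, 'r) ringed_space_data \<Rightarrow> 'a set \<Rightarrow> ('a \<Rightarrow> 'r) set" where
  "sub_sections X V =
     {s \<in> \<Pi>\<^sub>E z \<in> V. carrier (stalk X z).
        \<forall>z \<in> V. \<exists>U. openin (top_of X) U \<and> z \<in> U \<and>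
          (\<exists>t \<in> carrier (sections X U). \<forall>y \<in> U \<inter> V. s y = restr X U (min_open X y) t)}"

definition rs_subspace :: "('a, 'r) ringed_space_data \<Rightarrow> 'a set \<Rightarrow> ('a, 'a \<Rightarrow> 'r) ringed_space_data"
where
  "rs_subspace X Z =
     \<lparr>top_of = subtopology (top_of X) Z,
      sections = \<lambda>V. \<lparr>carrier = sub_sections X V,
        mult = \<lambda>s t. \<lambda>z\<in>V. s z \<otimes>\<^bsub>stalk X z\<^esub> t z,
        one = \<lambda>z\<in>V. \<one>\<^bsub>stalk X z\<^esub>,
        zero = \<lambda>z\<in>V. \<zero>\<^bsub>stalk X z\<^esub>,
        add = \<lambda>s t. \<lambda>z\<in>V. s z \<oplus>\<^bsub>stalk X z\<^esub> t z\<rparr>,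
      restr = \<lambda>V W s. restrict s W\<rparr>"

definition rs_inclusion ::
  "('a, 'r) ringed_space_data \<Rightarrow> 'a set \<Rightarrow> ('a, 'a \<Rightarrow> 'r, 'a, 'r) rs_map"
where
  "rs_inclusion X Z =
     \<lparr>pt = \<lambda>z. z, comor = \<lambda>z t. \<lambda>y \<in> min_open (rs_subspace X Z) z. stalk_restr X z y t\<rparr>"

definition strong_deformation_retract :: "('a, 'r) ringed_space_data \<Rightarrow> 'a set \<Rightarrow> bool" where
  "strong_deformation_retract X Z \<longleftrightarrow> Z \<subseteq> points X \<and>
     (\<exists>r. rs_morphism X (rs_subspace X Z) r \<and>
        rs_map_eq (rs_subspace X Z) (rs_subspace X Z) (rs_comp r (rs_inclusion X Z)) rs_id \<and>
        rs_homotopic_with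
          (\<lambda>f. rs_map_eq (rs_subspace X Z) X (rs_comp f (rs_inclusion X Z)) (rs_inclusion X Z))
          X X (rs_comp (rs_inclusion X Z) r) rs_id)"


section \<open>Beat points, minimal spaces and cores\<close>

definition down_beat_point :: "('a, 'r) ringed_space_data \<Rightarrow> 'a \<Rightarrow> bool" where
  "down_beat_point X p \<longleftrightarrow> p \<in> points X \<and>
     (\<exists>q \<in> (top_of X closure_of {p}) - {p}.
        \<forall>y \<in> (top_of X closure_of {p}) - {p}. point_le X y q)"

definition up_beat_point :: "('a, 'r) ringed_space_data \<Rightarrow> 'a \<Rightarrow> bool" where
  "up_beat_point X p \<longleftrightarrow> p \<in> points X \<and>
     (\<exists>q \<in> min_open X p - {p}.
        (\<forall>y \<in> min_open X p - {p}. point_le X q y) \<and>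
        stalk_restr X p q \<in> ring_iso (stalk X p) (stalk X q))"

definition beat_point :: "('a, 'r) ringed_space_data \<Rightarrow> 'a \<Rightarrow> bool" where
  "beat_point X p \<longleftrightarrow> down_beat_point X p \<or> up_beat_point X p"

definition minimal_ringed_finite_space :: "('a, 'r) ringed_space_data \<Rightarrow> bool" where
  "minimal_ringed_finite_space X \<longleftrightarrow>
     ringed_finite_space X \<and> t0_space (top_of X) \<and> (\<forall>p \<in> points X. \<not> beat_point X p)"

definition is_core :: "('a, 'r) ringed_space_data \<Rightarrow> 'a set \<Rightarrow> bool" where
  "is_core X Z \<longleftrightarrow>
     strong_deformation_retract X Z \<and> minimal_ringed_finite_space (rs_subspace X Z)"

end

theory Submission
  imports Defs
begin

text \<open>
  Let \<open>X\<close> be minimal and \<open>f\<close> an endomorphism comparable to the identity. If \<open>f \<ge> id\<close> and \<open>p\<close> is a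
  maximal point moved by \<open>f\<close>, then \<open>f p\<close> is the least point above \<open>p\<close>, and \<open>f\<^sup>#\<^sub>p\<close> inverts the
  restriction \<open>\<O>\<^sub>p \<rightarrow> \<O>\<^bsub>f p\<^esub>\<close>, so \<open>p\<close> is an up beat point; dually, \<open>f \<le> id\<close> yields a down beat
  point. Hence only the identity is homotopic to the identity, and homotopy equivalences between
  minimal spaces are isomorphisms. A core exists: take a strong deformation retract with the fewest points;
  two points violating \<open>T\<^sub>0\<close>, or a beat point, would allow one more point to be pushed away.
\<close>


section \<open>The specialization preorder\<close>

text \<open>The two directions of comparison are unequal. Lowering the values of a morphism
  monotonically yields a morphism again, because its comorphisms can be precomposed with
  restrictions; raising the values requires these restrictions to be inverted. This is why up beat
  points carry a condition on rings and down beat points do not, and why two points that violate T0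
  can be merged by lowering one to the other.

  A point \<open>p\<close> is pushed out of a retract by redirecting to another point whatever the
  retraction sends to \<open>p\<close>. The new map is comparable with the old one, and a homotopy
  relative to the larger set is also one relative to the smaller set, so a single extra comparison
  completes the new homotopy.

  Since HOL functions carry irrelevant values off the carriers, all equalities of morphisms hold
  only up to \<open>rs_map_eq\<close>, and comparability has to be transported along it.\<close>

lemma min_open_subset: "openin (top_of X) U \<Longrightarrow> p \<in> U \<Longrightarrow> min_open X p \<subseteq> U"
  by (auto simp: min_open_def)

lemma point_le_points:
  assumes "point_le X p q"
  shows "p \<in> points X" "q \<in> points X"
  using assms min_open_subset[of X "points X" p] by (auto simp: point_le_def)

lemma point_le_refl: "p \<in> points X \<Longrightarrow> point_le X p p"
  by (auto simp: point_le_def min_open_def)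

lemma point_le_trans: "point_le X p q \<Longrightarrow> point_le X q r \<Longrightarrow> point_le X p r"
  by (auto simp: point_le_def min_open_def)

lemma point_le_min_open_subset: "point_le X p q \<Longrightarrow> min_open X q \<subseteq> min_open X p"
  by (auto simp: point_le_def min_open_def)

lemma continuous_map_point_le:
  assumes "continuous_map (top_of X) (top_of Y) f" "point_le X p q"
  shows "point_le Y (f p) (f q)"
  unfolding point_le_def min_open_def
proof (intro conjI InterI)
  show "f p \<in> points Y"
    using assms point_le_points by (fastforce simp: continuous_map_def)
next
  fix V assume V: "V \<in> {U. openin (top_of Y) U \<and> f p \<in> U}"
  then have "openin (top_of X) {x \<in> points X. f x \<in> V}"
    using assms by (simp add: continuous_map_def)
  from min_open_subset[OF this, of p] show "f q \<in> V"
    using V assms(2) by (auto simp: point_le_def)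
qed

lemma point_le_iff:
  "point_le X p q \<longleftrightarrow> p \<in> points X \<and> (\<forall>U. openin (top_of X) U \<longrightarrow> p \<in> U \<longrightarrow> q \<in> U)"
  by (auto simp: point_le_def min_open_def)

text \<open>Two points lie below each other exactly when they have the same open
  neighbourhoods.\<close>

lemma t0_space_iff_point_le_antisym:
  "t0_space (top_of X) \<longleftrightarrow> (\<forall>p q. point_le X p q \<longrightarrow> point_le X q p \<longrightarrow> p = q)"
proof
  assume t0: "t0_space (top_of X)"
  show "\<forall>p q. point_le X p q \<longrightarrow> point_le X q p \<longrightarrow> p = q"
  proof (intro allI impI)
    fix p q assume "point_le X p q" "point_le X q p"
    then have "p \<in> points X" "q \<in> points X"
      and "\<And>U. openin (top_of X) U \<Longrightarrow> p \<in> U \<longleftrightarrow> q \<in> U"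
      by (auto simp: point_le_iff)
    with t0 show "p = q"
      unfolding t0_space_def by metis
  qed
next
  assume *: "\<forall>p q. point_le X p q \<longrightarrow> point_le X q p \<longrightarrow> p = q"
  show "t0_space (top_of X)"
    unfolding t0_space_def
  proof (intro ballI impI)
    fix x y assume xy: "x \<in> points X" "y \<in> points X" "x \<noteq> y"
    then have "\<not> point_le X x y \<or> \<not> point_le X y x" using * by metis
    then show "\<exists>U. openin (top_of X) U \<and> (x \<notin> U) = (y \<in> U)"
      using xy(1,2) unfolding point_le_iff by metis
  qed
qed

text \<open>Turns the closure in \<open>down_beat_point\<close> into a condition on the
  order.\<close>

lemma mem_closure_of_singleton_iff:
  assumes "p \<in> points X"
  shows "y \<in> top_of X closure_of {p} \<longleftrightarrow> point_le X y p"
  by (simp add: in_closure_of point_le_iff) metis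

section \<open>Minimal neighbourhoods and stalk restrictions in a finite space\<close>

context ringed_finite_space
begin

text \<open>Finiteness of the space enters here: all open sets lie in a finite power set, so the
  intersection is a finite one.\<close>

lemma openin_min_open:
  assumes "p \<in> points X"
  shows "openin (top_of X) (min_open X p)"
proof -
  have "{U. openin (top_of X) U \<and> p \<in> U} \<subseteq> Pow (points X)"
    by (auto dest: openin_subset)
  then have "finite {U. openin (top_of X) U \<and> p \<in> U}"
    using finite_points finite_subset by blast
  then show ?thesis
    unfolding min_open_def using assms by (intro openin_Inter) auto
qed

lemma mem_min_open: "p \<in> points X \<Longrightarrow> p \<in> min_open X p"
  by (simp add: min_open_def)

text \<open>By monotonicity the preimage of an open set is closed upwards, hence a union of minimal
  neighbourhoods. With \<open>continuous_map_point_le\<close>, continuity becomes a matter of the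
  order alone.\<close>

lemma continuous_map_if_mono:
  assumes mono: "\<And>p q. point_le X p q \<Longrightarrow> point_le Y (f p) (f q)"
  shows "continuous_map (top_of X) (top_of Y) f"
  unfolding continuous_map_def
proof (intro conjI allI impI)
  show "f \<in> points X \<rightarrow> points Y"
    by (rule funcsetI) (rule point_le_points(1)[OF mono[OF point_le_refl]])
next
  fix V assume V: "openin (top_of Y) V"
  show "openin (top_of X) {x \<in> points X. f x \<in> V}"
  proof (subst openin_subopen, intro ballI exI conjI subsetI)
    fix p assume p: "p \<in> {x \<in> points X. f x \<in> V}"
    then show "openin (top_of X) (min_open X p)" "p \<in> min_open X p"
      by (simp_all add: openin_min_open mem_min_open)
    fix q assume "q \<in> min_open X p"
    then have le: "point_le X p q" using p by (simp add: point_le_def)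
    then have "f q \<in> V"
      using mono[OF le] V p by (simp add: point_le_iff)
    then show "q \<in> {x \<in> points X. f x \<in> V}"
      using point_le_points(2)[OF le] by simp
  qed
qed

lemma cring_stalk: "p \<in> points X \<Longrightarrow> cring (stalk X p)"
  unfolding stalk_def by (intro cring_sections openin_min_open)

lemma stalk_restr_hom:
  assumes "point_le X p q"
  shows "stalk_restr X p q \<in> ring_hom (stalk X p) (stalk X q)"
  unfolding stalk_restr_def stalk_def
  using assms by (intro restr_hom openin_min_open point_le_min_open_subset)
    (auto dest: point_le_points)

lemma stalk_restr_closed:
  "point_le X p q \<Longrightarrow> s \<in> carrier (stalk X p) \<Longrightarrow> stalk_restr X p q s \<in> carrier (stalk X q)"
  by (rule ring_hom_closed[OF stalk_restr_hom])

lemma stalk_restr_refl: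
  "p \<in> points X \<Longrightarrow> s \<in> carrier (stalk X p) \<Longrightarrow> stalk_restr X p p s = s"
  unfolding stalk_restr_def stalk_def by (intro restr_id openin_min_open)

lemma stalk_restr_stalk_restr:
  "point_le X p q \<Longrightarrow> point_le X q r \<Longrightarrow> s \<in> carrier (stalk X p)
     \<Longrightarrow> stalk_restr X q r (stalk_restr X p q s) = stalk_restr X p r s"
  unfolding stalk_restr_def stalk_def
  by (intro restr_restr openin_min_open point_le_min_open_subset) (auto dest: point_le_points)

text \<open>Allows unmoved values to be treated like moved ones when a morphism is raised.\<close>

lemma stalk_restr_refl_iso:
  assumes "p \<in> points X"
  shows "stalk_restr X p p \<in> ring_iso (stalk X p) (stalk X p)"
proof -
  have "bij_betw (stalk_restr X p p) (carrier (stalk X p)) (carrier (stalk X p))"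
    by (rule bij_betw_byWitness[where f' = "\<lambda>s. s"]) (simp_all add: stalk_restr_refl[OF assms] image_subset_iff)
  then show ?thesis
    using stalk_restr_hom[OF point_le_refl[OF assms]] by (simp add: ring_iso_def)
qed

end


section \<open>Morphisms and homotopies\<close>

lemma rs_morphism_point_le: "rs_morphism X Y f \<Longrightarrow> point_le X p q \<Longrightarrow> point_le Y (pt f p) (pt f q)"
  unfolding rs_morphism_def by (rule continuous_map_point_le) auto

lemma rs_morphism_points: "rs_morphism X Y f \<Longrightarrow> p \<in> points X \<Longrightarrow> pt f p \<in> points Y"
  by (rule point_le_points(1)[OF rs_morphism_point_le[OF _ point_le_refl]])

lemma rs_morphism_hom:
  "rs_morphism X Y f \<Longrightarrow> p \<in> points X \<Longrightarrow> comor f p \<in> ring_hom (stalk Y (pt f p)) (stalk X p)"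
  by (simp add: rs_morphism_def)

lemma rs_morphism_closed:
  "rs_morphism X Y f \<Longrightarrow> p \<in> points X \<Longrightarrow> s \<in> carrier (stalk Y (pt f p))
     \<Longrightarrow> comor f p s \<in> carrier (stalk X p)"
  by (rule ring_hom_closed[OF rs_morphism_hom])

lemma rs_morphism_compat:
  "rs_morphism X Y f \<Longrightarrow> point_le X p q \<Longrightarrow> s \<in> carrier (stalk Y (pt f p))
     \<Longrightarrow> stalk_restr X p q (comor f p s) = comor f q (stalk_restr Y (pt f p) (pt f q) s)"
  by (simp add: rs_morphism_def)

lemma rs_morphism_id: "rs_morphism X X rs_id"
  by (simp add: rs_morphism_def rs_id_def ring_hom_def)

lemma pt_rs_id [simp]: "pt rs_id p = p"
  by (simp add: rs_id_def)

lemma comor_rs_id [simp]: "comor rs_id p s = s"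
  by (simp add: rs_id_def)

lemma pt_rs_comp [simp]: "pt (rs_comp g f) p = pt g (pt f p)"
  by (simp add: rs_comp_def)

lemma comor_rs_comp [simp]: "comor (rs_comp g f) p s = comor f p (comor g (pt f p) s)"
  by (simp add: rs_comp_def)

lemma rs_comp_assoc: "rs_comp (rs_comp h g) f = rs_comp h (rs_comp g f)"
  by (simp add: rs_comp_def)

lemma rs_comp_id_left [simp]: "rs_comp rs_id f = f"
  by (simp add: rs_comp_def rs_id_def)

lemma rs_morphism_comp:
  assumes f: "rs_morphism X Y f" and g: "rs_morphism Y W g"
  shows "rs_morphism X W (rs_comp g f)"
  unfolding rs_morphism_def
proof (intro conjI ballI allI impI)
  have "continuous_map (top_of X) (top_of W) (pt g \<circ> pt f)"
    using f g unfolding rs_morphism_def by (intro continuous_map_compose[of _ "top_of Y"]) simp_all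
  then show "continuous_map (top_of X) (top_of W) (pt (rs_comp g f))"
    by (simp add: rs_comp_def o_def)
next
  fix p assume p: "p \<in> points X"
  have "comor f p \<circ> comor g (pt f p) \<in> ring_hom (stalk W (pt g (pt f p))) (stalk X p)"
    by (rule ring_hom_trans[OF rs_morphism_hom[OF g rs_morphism_points[OF f p]] rs_morphism_hom[OF f p]])
  then show "comor (rs_comp g f) p \<in> ring_hom (stalk W (pt (rs_comp g f) p)) (stalk X p)"
    by (simp add: rs_comp_def o_def)
next
  fix p q s assume le: "point_le X p q" and s: "s \<in> carrier (stalk W (pt (rs_comp g f) p))"
  have "pt f p \<in> points Y"
    by (rule rs_morphism_points[OF f point_le_points(1)[OF le]])
  then show "stalk_restr X p q (comor (rs_comp g f) p s) =
      comor (rs_comp g f) q (stalk_restr W (pt (rs_comp g f) p) (pt (rs_comp g f) q) s)"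
    using s le rs_morphism_closed[OF g]
    by (simp add: rs_morphism_compat[OF f] rs_morphism_compat[OF g] rs_morphism_point_le[OF f])
qed

section \<open>Comparison and equality of morphisms\<close>

lemma rs_map_leI:
  assumes "\<And>p. p \<in> points X \<Longrightarrow> point_le Y (pt f p) (pt g p)"
    and "\<And>p s. p \<in> points X \<Longrightarrow> s \<in> carrier (stalk Y (pt f p))
           \<Longrightarrow> comor g p (stalk_restr Y (pt f p) (pt g p) s) = comor f p s"
  shows "rs_map_le X Y f g"
  using assms by (simp add: rs_map_le_def)

lemma rs_map_leD:
  assumes "rs_map_le X Y f g" "p \<in> points X"
  shows "point_le Y (pt f p) (pt g p)"
    and "s \<in> carrier (stalk Y (pt f p))
           \<Longrightarrow> comor g p (stalk_restr Y (pt f p) (pt g p) s) = comor f p s"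
  using assms by (simp_all add: rs_map_le_def)

lemma rs_map_eqD:
  assumes "rs_map_eq X Y f g" "p \<in> points X"
  shows "pt g p = pt f p"
    and "s \<in> carrier (stalk Y (pt f p)) \<Longrightarrow> comor g p s = comor f p s"
  using assms by (simp_all add: rs_map_eq_def)

text \<open>Restriction along \<open>p \<le> p\<close> is the identity, so a homotopy may pass
  between two representations of one morphism in a single step.\<close>

lemma rs_map_le_if_eq:
  assumes "ringed_finite_space Y" "rs_morphism X Y f" "rs_map_eq X Y f g"
  shows "rs_map_le X Y f g"
proof -
  interpret ringed_finite_space Y by fact
  show ?thesis
    using rs_morphism_points[OF assms(2)]
    by (intro rs_map_leI)
      (simp_all add: rs_map_eqD[OF assms(3)] point_le_refl stalk_restr_refl)
qed

text \<open>In a homotopy to the identity, a neighbouring map is known to be the identity only up to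
  \<open>rs_map_eq\<close>; this lemma and the next one replace it by \<open>rs_id\<close> on either
  side of a comparison.\<close>

lemma rs_map_le_eq_trans:
  assumes "ringed_finite_space Y" "rs_map_le X Y f g" "rs_map_eq X Y g h"
  shows "rs_map_le X Y f h"
proof -
  interpret ringed_finite_space Y by fact
  show ?thesis
    by (intro rs_map_leI)
      (simp_all add: rs_map_eqD[OF assms(3)] rs_map_leD[OF assms(2)] stalk_restr_closed)
qed

lemma rs_map_eq_le_trans:
  assumes "rs_map_eq X Y f g" "rs_map_le X Y f h"
  shows "rs_map_le X Y g h"
  by (intro rs_map_leI) (simp_all add: rs_map_eqD[OF assms(1)] rs_map_leD[OF assms(2)])

text \<open>The condition on stalks is the compatibility of \<open>h\<close> with restriction along
  \<open>f p \<le> g p\<close>.\<close>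

lemma rs_map_le_comp_left:
  assumes h: "rs_morphism Y W h" and le: "rs_map_le X Y f g"
  shows "rs_map_le X W (rs_comp h f) (rs_comp h g)"
  unfolding rs_map_le_def
proof (intro ballI conjI)
  fix p assume "p \<in> points X"
  then have p: "point_le Y (pt f p) (pt g p)"
    and c: "\<And>s. s \<in> carrier (stalk Y (pt f p)) \<Longrightarrow>
      comor g p (stalk_restr Y (pt f p) (pt g p) s) = comor f p s"
    using le by (auto simp: rs_map_le_def)
  show "point_le W (pt (rs_comp h f) p) (pt (rs_comp h g) p)"
    using rs_morphism_point_le[OF h p] by simp
  fix s assume s: "s \<in> carrier (stalk W (pt (rs_comp h f) p))"
  then have "comor h (pt f p) s \<in> carrier (stalk Y (pt f p))"
    using rs_morphism_closed[OF h] point_le_points[OF p] by simp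
  from c[OF this] rs_morphism_compat[OF h p] s
  show "comor (rs_comp h g) p (stalk_restr W (pt (rs_comp h f) p) (pt (rs_comp h g) p) s)
      = comor (rs_comp h f) p s" by simp
qed

lemma rs_map_le_comp_right:
  assumes k: "rs_morphism V X k" and le: "rs_map_le X Y f g"
  shows "rs_map_le V Y (rs_comp f k) (rs_comp g k)"
  by (intro rs_map_leI) (simp_all add: rs_map_leD[OF le] rs_morphism_points[OF k])

text \<open>A single link of a homotopy, with the requirements on both of its ends built in, so that
  chains become a reflexive transitive closure and admit its induction rules.\<close>

definition homotopy_step ::
  "(('a, 'r, 'b, 's) rs_map \<Rightarrow> bool) \<Rightarrow> ('a, 'r) ringed_space_data \<Rightarrow>
   ('b, 's) ringed_space_data \<Rightarrow> ('a, 'r, 'b, 's) rs_map \<Rightarrow> ('a, 'r, 'b, 's) rs_map \<Rightarrow> bool"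
where
  "homotopy_step P X Y f g \<longleftrightarrow> rs_morphism X Y f \<and> P f \<and> rs_morphism X Y g \<and> P g \<and>
     (rs_map_le X Y f g \<or> rs_map_le X Y g f)"

text \<open>A chain of length zero has no link that certifies its only map, hence the separate
  conditions on \<open>f\<close>.\<close>

lemma rs_homotopic_with_iff:
  "rs_homotopic_with P X Y f g \<longleftrightarrow> rs_morphism X Y f \<and> P f \<and> (homotopy_step P X Y)\<^sup>*\<^sup>* f g"
  (is "?L \<longleftrightarrow> ?R")
proof
  assume ?L
  then obtain F n where F: "F 0 = f" "F n = g"
    "\<And>j. j \<le> n \<Longrightarrow> rs_morphism X Y (F j) \<and> P (F j)"
    "\<And>j. j < n \<Longrightarrow> rs_map_le X Y (F j) (F (Suc j)) \<or> rs_map_le X Y (F (Suc j)) (F j)"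
    unfolding rs_homotopic_with_def by blast
  then have "\<forall>j < n. homotopy_step P X Y (F j) (F (Suc j))"
    by (simp add: homotopy_step_def)
  with F have "(homotopy_step P X Y ^^ n) f g"
    by (auto simp: relpowp_fun_conv)
  then show ?R
    using F(3)[of 0] F(1) relpowp_imp_rtranclp by fastforce
next
  assume R: ?R
  then obtain n where "(homotopy_step P X Y ^^ n) f g"
    using rtranclp_imp_relpowp by metis
  then obtain F where F: "F 0 = f" "F n = g" "\<And>j. j < n \<Longrightarrow> homotopy_step P X Y (F j) (F (Suc j))"
    by (auto simp: relpowp_fun_conv)
  have "rs_morphism X Y (F j) \<and> P (F j)" if "j \<le> n" for j
    using F R that by (cases j) (auto simp: homotopy_step_def Suc_le_eq)
  then show ?L
    unfolding rs_homotopic_with_def using F by (auto simp: homotopy_step_def intro!: exI[of _ F] exI[of _ n])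
qed

lemma rs_homotopic_with_trans:
  "rs_homotopic_with P X Y f g \<Longrightarrow> rs_homotopic_with P X Y g h \<Longrightarrow> rs_homotopic_with P X Y f h"
  by (auto simp: rs_homotopic_with_iff)

lemma rs_homotopic_with_step: "homotopy_step P X Y f g \<Longrightarrow> rs_homotopic_with P X Y f g"
  by (auto simp: rs_homotopic_with_iff homotopy_step_def)

text \<open>Reduces composition on either side and weakening of the side condition to a check of
  single links; the last assumption takes care of the starting map.\<close>

lemma rs_homotopic_with_image:
  assumes "rs_homotopic_with P X Y f g"
    and "\<And>f g. homotopy_step P X Y f g \<Longrightarrow> homotopy_step Q X' Y' (\<Phi> f) (\<Phi> g)"
    and "\<And>f. rs_morphism X Y f \<Longrightarrow> P f \<Longrightarrow> rs_morphism X' Y' (\<Phi> f) \<and> Q (\<Phi> f)"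
  shows "rs_homotopic_with Q X' Y' (\<Phi> f) (\<Phi> g)"
proof -
  have "(homotopy_step P X Y)\<^sup>*\<^sup>* f g" and f: "rs_morphism X Y f" "P f"
    using assms(1) by (auto simp: rs_homotopic_with_iff)
  then have "(homotopy_step Q X' Y')\<^sup>*\<^sup>* (\<Phi> f) (\<Phi> g)"
    by (induction rule: rtranclp_induct) (auto intro: rtranclp.rtrancl_into_rtrancl assms(2))
  then show ?thesis
    using assms(3) f by (auto simp: rs_homotopic_with_iff)
qed

lemma rs_homotopic_with_mono:
  assumes "rs_homotopic_with P X Y f g" "\<And>f. P f \<Longrightarrow> Q f"
  shows "rs_homotopic_with Q X Y f g"
  using rs_homotopic_with_image[where \<Phi> = "\<lambda>f. f", OF assms(1)] assms(2)
  by (auto simp: homotopy_step_def)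

lemma rs_homotopic_comp_left:
  assumes "rs_homotopic X Y f g" "rs_morphism Y W h"
  shows "rs_homotopic X W (rs_comp h f) (rs_comp h g)"
  using assms unfolding rs_homotopic_def
  by (elim rs_homotopic_with_image)
    (auto simp: homotopy_step_def intro: rs_morphism_comp rs_map_le_comp_left)

lemma rs_homotopic_comp_right:
  assumes "rs_homotopic X Y f g" "rs_morphism V X k"
  shows "rs_homotopic V Y (rs_comp f k) (rs_comp g k)"
  using assms unfolding rs_homotopic_def
  by (elim rs_homotopic_with_image[where \<Phi> = "\<lambda>f. rs_comp f k"])
    (auto simp: homotopy_step_def intro: rs_morphism_comp rs_map_le_comp_right)

lemma rs_homotopic_if_eq:
  assumes "ringed_finite_space Y" "rs_morphism X Y f" "rs_morphism X Y g" "rs_map_eq X Y f g"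
  shows "rs_homotopic X Y f g"
  unfolding rs_homotopic_def using assms rs_map_le_if_eq
  by (intro rs_homotopic_with_step) (auto simp: homotopy_step_def)

section \<open>Composition of homotopy equivalences\<close>

lemma rs_homotopy_equivalent_sym:
  "rs_homotopy_equivalent X Y \<Longrightarrow> rs_homotopy_equivalent Y X"
  unfolding rs_homotopy_equivalent_def rs_homotopy_equivalence_def by blast

text \<open>Contract the inner pair \<open>g'\<close>, \<open>f'\<close> first; what remains is
  \<open>g\<close> after \<open>f\<close>. Transitivity uses this for both composites.\<close>

lemma rs_homotopic_comp_id:
  assumes f: "rs_morphism X Y f" "rs_morphism Y X g" "rs_homotopic X X (rs_comp g f) rs_id"
    and f': "rs_morphism Y W f'" "rs_morphism W Y g'" "rs_homotopic Y Y (rs_comp g' f') rs_id"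
  shows "rs_homotopic X X (rs_comp (rs_comp g g') (rs_comp f' f)) rs_id"
proof -
  have "rs_homotopic X X (rs_comp g (rs_comp (rs_comp g' f') f)) (rs_comp g (rs_comp rs_id f))"
    by (rule rs_homotopic_comp_left[OF rs_homotopic_comp_right[OF f'(3) f(1)] f(2)])
  with f(3) show ?thesis
    unfolding rs_homotopic_def by (auto simp: rs_comp_assoc intro: rs_homotopic_with_trans)
qed

lemma rs_homotopy_equivalent_trans:
  assumes "rs_homotopy_equivalent X Y" "rs_homotopy_equivalent Y W"
  shows "rs_homotopy_equivalent X W"
  using assms unfolding rs_homotopy_equivalent_def rs_homotopy_equivalence_def
  by (blast intro: rs_morphism_comp rs_homotopic_comp_id)

lemma rs_isomorphic_imp_homotopy_equivalent:
  assumes "ringed_finite_space X" "ringed_finite_space Y" "rs_isomorphic X Y"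
  shows "rs_homotopy_equivalent X Y"
  using assms unfolding rs_isomorphic_def rs_isomorphism_def
    rs_homotopy_equivalent_def rs_homotopy_equivalence_def
  by (blast intro: rs_homotopic_if_eq rs_morphism_comp rs_morphism_id)


section \<open>Rigidity of minimal spaces\<close>

lemma minimal_map_eq_id_if_ge:
  assumes min: "minimal_ringed_finite_space X" and f: "rs_morphism X X f"
    and ge: "rs_map_le X X rs_id f"
  shows "rs_map_eq X X f rs_id"
proof -
  interpret ringed_finite_space X
    using min by (simp add: minimal_ringed_finite_space_def)
  have antisym: "p = q" if "point_le X p q" "point_le X q p" for p q
    using min that unfolding minimal_ringed_finite_space_def t0_space_iff_point_le_antisym by blast
  have le: "point_le X p (pt f p)" if "p \<in> points X" for p
    using ge that by (simp add: rs_map_le_def)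
  have retr: "comor f p (stalk_restr X p (pt f p) s) = s"
    if "p \<in> points X" "s \<in> carrier (stalk X p)" for p s
    using ge that by (simp add: rs_map_le_def)
  have fix_pt: "pt f p = p" if "p \<in> points X" for p
    using that
  proof (induction "card (min_open X p)" arbitrary: p rule: less_induct)
    case less
    note p = less.prems
    let ?q = "pt f p"
    \<comment> \<open>By antisymmetry \<open>p\<close> is missing from the minimal neighbourhood of
      any other point above it. The cardinality therefore drops, and the induction runs down from
      the maximal points.\<close>
    have above: "pt f y = y" if y: "point_le X p y" "y \<noteq> p" for y
    proof (rule less.hyps)
      show yX: "y \<in> points X" by (rule point_le_points(2)[OF y(1)])
      have "p \<notin> min_open X y"
        using antisym[OF y(1)] y(2) yX by (auto simp: point_le_def)
      then have "min_open X y \<subset> min_open X p"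
        using point_le_min_open_subset[OF y(1)] mem_min_open[OF p] by blast
      moreover have "finite (min_open X p)"
        using openin_subset[OF openin_min_open[OF p]] finite_points finite_subset by blast
      ultimately show "card (min_open X y) < card (min_open X p)"
        by (rule psubset_card_mono[rotated])
    qed
    show ?case
    proof (rule ccontr)
      assume ne: "?q \<noteq> p"
      have fq: "pt f ?q = ?q" by (rule above[OF le[OF p] ne])
      have q: "?q \<in> points X" by (rule point_le_points(2)[OF le[OF p]])
      \<comment> \<open>Compatibility along \<open>p \<le> ?q\<close> rewrites the left side as
        \<open>comor f ?q\<close> after a restriction from \<open>?q\<close> to
        \<open>pt f ?q\<close>. As \<open>f\<close> fixes \<open>?q\<close>, the identity
        \<open>retr\<close> at \<open>?q\<close> cancels the two.\<close>
      have sect: "stalk_restr X p ?q (comor f p s) = s" if "s \<in> carrier (stalk X ?q)" for s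
        using rs_morphism_compat[OF f le[OF p] that] retr[OF q that] fq by simp
      have "bij_betw (stalk_restr X p ?q) (carrier (stalk X p)) (carrier (stalk X ?q))"
        by (rule bij_betw_byWitness[where f' = "comor f p"])
          (simp_all add: retr[OF p] sect stalk_restr_closed[OF le[OF p]] rs_morphism_closed[OF f p]
            image_subset_iff)
      then have "stalk_restr X p ?q \<in> ring_iso (stalk X p) (stalk X ?q)"
        using stalk_restr_hom[OF le[OF p]] by (simp add: ring_iso_def)
      \<comment> \<open>Monotonicity gives \<open>pt f p \<le> pt f y\<close>, and \<open>f\<close>
        already fixes \<open>y\<close>.\<close>
      moreover have "point_le X ?q y" if "y \<in> min_open X p - {p}" for y
      proof -
        have y: "point_le X p y" "y \<noteq> p"
          using that p by (simp_all add: point_le_def)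
        show ?thesis
          using rs_morphism_point_le[OF f y(1)] above[OF y] by simp
      qed
      moreover have "?q \<in> min_open X p - {p}"
        using le[OF p] ne by (simp add: point_le_def)
      ultimately have "up_beat_point X p"
        unfolding up_beat_point_def using p by blast
      then show False
        using min p by (simp add: minimal_ringed_finite_space_def beat_point_def)
    qed
  qed
  show ?thesis
    unfolding rs_map_eq_def using fix_pt retr stalk_restr_refl by simp
qed

text \<open>Down beat points are defined by the order, so the points are handled by order alone,
  with induction running up from the minimal ones. Once they are fixed, \<open>f \<le> id\<close>
  says that each comorphism is the restriction along \<open>p \<le> p\<close>.\<close>

lemma minimal_map_eq_id_if_le:
  assumes min: "minimal_ringed_finite_space X" and f: "rs_morphism X X f"
    and le_id: "rs_map_le X X f rs_id"
  shows "rs_map_eq X X f rs_id"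
proof -
  interpret ringed_finite_space X
    using min by (simp add: minimal_ringed_finite_space_def)
  have antisym: "p = q" if "point_le X p q" "point_le X q p" for p q
    using min that unfolding minimal_ringed_finite_space_def t0_space_iff_point_le_antisym by blast
  have le: "point_le X (pt f p) p" if "p \<in> points X" for p
    using le_id that by (simp add: rs_map_le_def)
  have fix_pt: "pt f p = p" if "p \<in> points X" for p
    using that
  proof (induction "card {y. point_le X y p}" arbitrary: p rule: less_induct)
    case less
    note p = less.prems
    have below: "pt f y = y" if y: "point_le X y p" "y \<noteq> p" for y
    proof (rule less.hyps)
      show "y \<in> points X" by (rule point_le_points(1)[OF y(1)])
      have "\<not> point_le X p y" using antisym[OF y(1)] y(2) by blast
      then have "{z. point_le X z y} \<subset> {z. point_le X z p}"
        using point_le_trans[OF _ y(1)] point_le_refl[OF p] by blast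
      moreover have "finite {z. point_le X z p}"
        by (rule finite_subset[OF _ finite_points]) (auto dest: point_le_points(1))
      ultimately show "card {z. point_le X z y} < card {z. point_le X z p}"
        by (rule psubset_card_mono[rotated])
    qed
    show ?case
    proof (rule ccontr)
      assume "pt f p \<noteq> p"
      moreover have "point_le X y (pt f p)" if "point_le X y p" "y \<noteq> p" for y
        using rs_morphism_point_le[OF f that(1)] below[OF that] by simp
      ultimately have "down_beat_point X p"
        unfolding down_beat_point_def using p le[OF p]
        by (intro conjI bexI[of _ "pt f p"]) (simp_all add: mem_closure_of_singleton_iff)
      then show False
        using min p by (simp add: minimal_ringed_finite_space_def beat_point_def)
    qed
  qed
  show ?thesis
    unfolding rs_map_eq_def
  proof (intro ballI conjI)
    fix p assume p: "p \<in> points X"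
    then show "pt f p = pt rs_id p" by (simp add: fix_pt)
    show "comor f p s = comor rs_id p s" if "s \<in> carrier (stalk X (pt f p))" for s
      using rs_map_leD(2)[OF le_id p that] p that by (simp add: fix_pt stalk_restr_refl)
  qed
qed

text \<open>Induction from the identity end of the chain: a map linked to one that equals the
  identity is itself comparable with the identity.\<close>

lemma minimal_map_eq_id_if_homotopic:
  assumes min: "minimal_ringed_finite_space X" and "rs_homotopic X X f rs_id"
  shows "rs_map_eq X X f rs_id"
proof -
  have X: "ringed_finite_space X"
    using min by (simp add: minimal_ringed_finite_space_def)
  have "(homotopy_step (\<lambda>_. True) X X)\<^sup>*\<^sup>* f rs_id"
    using assms(2) by (simp add: rs_homotopic_def rs_homotopic_with_iff)
  then show ?thesis
  proof (induction rule: converse_rtranclp_induct)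
    case base
    show ?case by (simp add: rs_map_eq_def)
  next
    case (step f g)
    then have f: "rs_morphism X X f" by (simp add: homotopy_step_def)
    from step(1) consider "rs_map_le X X f g" | "rs_map_le X X g f"
      by (auto simp: homotopy_step_def)
    then show ?case
    proof cases
      case 1
      show ?thesis
        by (rule minimal_map_eq_id_if_le[OF min f rs_map_le_eq_trans[OF X 1 step.IH]])
    next
      case 2
      show ?thesis
        by (rule minimal_map_eq_id_if_ge[OF min f rs_map_eq_le_trans[OF step.IH 2]])
    qed
  qed
qed

lemma minimal_homotopy_equivalence_isomorphism:
  assumes "minimal_ringed_finite_space X" "minimal_ringed_finite_space Y"
    "rs_homotopy_equivalence X Y f"
  shows "rs_isomorphism X Y f"
  using assms(3) minimal_map_eq_id_if_homotopic[OF assms(1)] minimal_map_eq_id_if_homotopic[OF assms(2)]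
  unfolding rs_homotopy_equivalence_def rs_isomorphism_def by blast


section \<open>Subspaces\<close>

lemma rs_subspace_simps:
  "top_of (rs_subspace X Z) = subtopology (top_of X) Z"
  "restr (rs_subspace X Z) V W s = restrict s W"
  "carrier (sections (rs_subspace X Z) V) = sub_sections X V"
  "s \<oplus>\<^bsub>sections (rs_subspace X Z) V\<^esub> t = (\<lambda>z\<in>V. s z \<oplus>\<^bsub>stalk X z\<^esub> t z)"
  "s \<otimes>\<^bsub>sections (rs_subspace X Z) V\<^esub> t = (\<lambda>z\<in>V. s z \<otimes>\<^bsub>stalk X z\<^esub> t z)"
  "\<zero>\<^bsub>sections (rs_subspace X Z) V\<^esub> = (\<lambda>z\<in>V. \<zero>\<^bsub>stalk X z\<^esub>)"
  "\<one>\<^bsub>sections (rs_subspace X Z) V\<^esub> = (\<lambda>z\<in>V. \<one>\<^bsub>stalk X z\<^esub>)"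
  by (simp_all add: rs_subspace_def)

lemma carrier_stalk_rs_subspace:
  "carrier (stalk (rs_subspace X Z) z) = sub_sections X (min_open (rs_subspace X Z) z)"
  by (simp add: stalk_def rs_subspace_simps)

lemma rs_inclusion_simps:
  "pt (rs_inclusion X Z) z = z"
  "comor (rs_inclusion X Z) z t = (\<lambda>y \<in> min_open (rs_subspace X Z) z. stalk_restr X z y t)"
  by (simp_all add: rs_inclusion_def)

lemma points_rs_subspace: "Z \<subseteq> points X \<Longrightarrow> points (rs_subspace X Z) = Z"
  by (auto simp: rs_subspace_def)

lemma min_open_rs_subspace:
  assumes "Z \<subseteq> points X" "z \<in> Z"
  shows "min_open (rs_subspace X Z) z = min_open X z \<inter> Z"
proof -
  have "{U. openin (top_of (rs_subspace X Z)) U \<and> z \<in> U} =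
      (\<lambda>U. U \<inter> Z) ` {U. openin (top_of X) U \<and> z \<in> U}"
    using assms by (auto simp: rs_subspace_def openin_subtopology)
  moreover have "points X \<in> {U. openin (top_of X) U \<and> z \<in> U}"
    using assms by auto
  ultimately show ?thesis
    unfolding min_open_def by auto
qed

lemma point_le_rs_subspace_iff:
  assumes "Z \<subseteq> points X"
  shows "point_le (rs_subspace X Z) z y \<longleftrightarrow> z \<in> Z \<and> y \<in> Z \<and> point_le X z y"
  unfolding point_le_def using assms
  by (auto simp: points_rs_subspace min_open_rs_subspace)

section \<open>Sections of a subspace as compatible families of germs\<close>

context ringed_finite_space
begin

text \<open>
  In a finite space a germ at \<open>z\<close> lives on \<open>U\<^sub>z\<close>, so the local condition defining the sections over
  \<open>V\<close> becomes compatibility of the germs along \<open>\<le>\<close>.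
\<close>

lemma sub_sections_iff:
  assumes V: "V \<subseteq> points X"
  shows "s \<in> sub_sections X V \<longleftrightarrow>
    s \<in> (\<Pi>\<^sub>E z \<in> V. carrier (stalk X z)) \<and>
    (\<forall>z \<in> V. \<forall>y \<in> V. point_le X z y \<longrightarrow> s y = stalk_restr X z y (s z))"
    (is "?L \<longleftrightarrow> ?R")
proof
  assume L: ?L
  have "s y = stalk_restr X z y (s z)" if "z \<in> V" "y \<in> V" and le: "point_le X z y" for z y
  proof -
    obtain U t where U: "openin (top_of X) U" "z \<in> U" and t: "t \<in> carrier (sections X U)"
      and st: "\<And>y. y \<in> U \<inter> V \<Longrightarrow> s y = restr X U (min_open X y) t"
      using L \<open>z \<in> V\<close> unfolding sub_sections_def by auto
    have sub: "min_open X z \<subseteq> U" by (rule min_open_subset[OF U])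
    then have y: "y \<in> U" using le by (auto simp: point_le_def)
    have "restr X (min_open X z) (min_open X y) (restr X U (min_open X z) t)
        = restr X U (min_open X y) t"
      by (intro restr_restr U(1) openin_min_open sub t point_le_min_open_subset[OF le]
          point_le_points[OF le])
    then show ?thesis
      using st[of z] st[of y] U(2) that(1,2) y by (simp add: stalk_restr_def)
  qed
  with L show ?R by (auto simp: sub_sections_def)
next
  assume R: ?R
  have "\<exists>U. openin (top_of X) U \<and> z \<in> U \<and>
          (\<exists>t \<in> carrier (sections X U). \<forall>y \<in> U \<inter> V. s y = restr X U (min_open X y) t)"
    if z: "z \<in> V" for z
  proof (intro exI conjI bexI ballI)
    \<comment> \<open>The germ \<open>s z\<close> is itself a section over the minimal neighbourhood
      and serves as the local representative.\<close>
    show "openin (top_of X) (min_open X z)" "z \<in> min_open X z"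
      using z V by (auto intro: openin_min_open mem_min_open)
    show "s z \<in> carrier (sections X (min_open X z))"
      using R z by (auto simp: stalk_def)
    fix y assume "y \<in> min_open X z \<inter> V"
    then have "y \<in> V" "point_le X z y"
      using z V by (auto simp: point_le_def)
    then show "s y = restr X (min_open X z) (min_open X y) (s z)"
      using R z by (simp add: stalk_restr_def)
  qed
  with R show ?L by (auto simp: sub_sections_def)
qed

lemma sub_sectionsI:
  assumes "V \<subseteq> points X" "s \<in> extensional V"
    and "\<And>z. z \<in> V \<Longrightarrow> s z \<in> carrier (stalk X z)"
    and "\<And>z y. z \<in> V \<Longrightarrow> y \<in> V \<Longrightarrow> point_le X z y \<Longrightarrow> stalk_restr X z y (s z) = s y"
  shows "s \<in> sub_sections X V"
  unfolding sub_sections_iff[OF assms(1)] using assms(2-4) by (auto simp: PiE_iff)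

lemma sub_sections_closed: "s \<in> sub_sections X V \<Longrightarrow> z \<in> V \<Longrightarrow> s z \<in> carrier (stalk X z)"
  by (auto simp: sub_sections_def)

lemma sub_sections_extensional: "s \<in> sub_sections X V \<Longrightarrow> s \<in> extensional V"
  by (auto simp: sub_sections_def PiE_iff)

lemma sub_sections_compat:
  "V \<subseteq> points X \<Longrightarrow> s \<in> sub_sections X V \<Longrightarrow> z \<in> V \<Longrightarrow> y \<in> V \<Longrightarrow> point_le X z y
     \<Longrightarrow> stalk_restr X z y (s z) = s y"
  by (simp add: sub_sections_iff)

lemma sub_sections_restrict:
  assumes "V \<subseteq> points X" "W \<subseteq> V" "s \<in> sub_sections X V"
  shows "restrict s W \<in> sub_sections X W"
  using assms(2) by (intro sub_sectionsI) (auto intro: sub_sections_closed[OF assms(3)]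
    sub_sections_compat[OF assms(1,3)] assms(1)[THEN subsetD])

text \<open>The ring laws hold stalk by stalk. The content is closure: pointwise operations preserve
  compatible families because stalk restrictions are ring homomorphisms.\<close>

lemma cring_rs_subspace_sections:
  assumes V: "V \<subseteq> points X"
  shows "cring (sections (rs_subspace X Z) V)" (is "cring ?R")
proof -
  have st: "cring (stalk X z)" if "z \<in> V" for z
    using cring_stalk that V by blast
  note simprules = cring.cring_simprules[OF st] sub_sections_closed
  have hom: "stalk_restr X z y \<in> ring_hom (stalk X z) (stalk X y)" if "point_le X z y" for z y
    by (rule stalk_restr_hom[OF that])
  note R = rs_subspace_simps
  have add: "(\<lambda>z\<in>V. s z \<oplus>\<^bsub>stalk X z\<^esub> t z) \<in> sub_sections X V"
    and mult: "(\<lambda>z\<in>V. s z \<otimes>\<^bsub>stalk X z\<^esub> t z) \<in> sub_sections X V"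
    if "s \<in> sub_sections X V" "t \<in> sub_sections X V" for s t
    using that by (auto intro!: sub_sectionsI[OF V] simp: simprules
        ring_hom_add[OF hom] ring_hom_mult[OF hom] sub_sections_compat[OF V])
  have zero: "(\<lambda>z\<in>V. \<zero>\<^bsub>stalk X z\<^esub>) \<in> sub_sections X V"
    and one: "(\<lambda>z\<in>V. \<one>\<^bsub>stalk X z\<^esub>) \<in> sub_sections X V"
    by (auto intro!: sub_sectionsI[OF V] simp: simprules
        ring_hom_zero[OF hom cring.axioms(1) cring.axioms(1), OF _ st st] ring_hom_one[OF hom])
  have neg: "(\<lambda>z\<in>V. \<ominus>\<^bsub>stalk X z\<^esub> s z) \<in> sub_sections X V" if s: "s \<in> sub_sections X V" for s
  proof (rule sub_sectionsI[OF V])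
    fix z y assume zy: "z \<in> V" "y \<in> V" "point_le X z y"
    interpret ring_hom_cring "stalk X z" "stalk X y" "stalk_restr X z y"
      by (intro ring_hom_cring.intro ring_hom_cring_axioms.intro st zy hom)
    show "stalk_restr X z y ((\<lambda>z\<in>V. \<ominus>\<^bsub>stalk X z\<^esub> s z) z) = (\<lambda>z\<in>V. \<ominus>\<^bsub>stalk X z\<^esub> s z) y"
      using zy by (simp add: sub_sections_closed[OF s] sub_sections_compat[OF V s])
  qed (simp_all add: simprules(1-9) sub_sections_closed[OF s])
  have closed:
    "s \<in> carrier ?R \<Longrightarrow> t \<in> carrier ?R \<Longrightarrow> s \<oplus>\<^bsub>?R\<^esub> t \<in> carrier ?R"
    "s \<in> carrier ?R \<Longrightarrow> t \<in> carrier ?R \<Longrightarrow> s \<otimes>\<^bsub>?R\<^esub> t \<in> carrier ?R"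
    "\<zero>\<^bsub>?R\<^esub> \<in> carrier ?R" "\<one>\<^bsub>?R\<^esub> \<in> carrier ?R" for s t
    by (simp_all add: R add mult zero one)
  have eval: "(s \<oplus>\<^bsub>?R\<^esub> t) z = s z \<oplus>\<^bsub>stalk X z\<^esub> t z" "(s \<otimes>\<^bsub>?R\<^esub> t) z = s z \<otimes>\<^bsub>stalk X z\<^esub> t z"
    "\<zero>\<^bsub>?R\<^esub> z = \<zero>\<^bsub>stalk X z\<^esub>" "\<one>\<^bsub>?R\<^esub> z = \<one>\<^bsub>stalk X z\<^esub>" if "z \<in> V" for s t z
    using that by (simp_all add: R)
  have stalk: "s z \<in> carrier (stalk X z)" if "s \<in> carrier ?R" "z \<in> V" for s z
    using that by (auto simp: R intro: sub_sections_closed)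
  have eqI: "s = t" if "s \<in> carrier ?R" "t \<in> carrier ?R" "\<And>z. z \<in> V \<Longrightarrow> s z = t z" for s t
    using that by (intro extensionalityI[of _ V]) (auto simp: R intro: sub_sections_extensional)
  show ?thesis
  proof (intro cringI abelian_groupI comm_monoidI)
    fix s assume s: "s \<in> carrier ?R"
    show "\<exists>t \<in> carrier ?R. t \<oplus>\<^bsub>?R\<^esub> s = \<zero>\<^bsub>?R\<^esub>"
    proof
      show "(\<lambda>z\<in>V. \<ominus>\<^bsub>stalk X z\<^esub> s z) \<in> carrier ?R"
        using s neg by (simp add: R)
      then show "(\<lambda>z\<in>V. \<ominus>\<^bsub>stalk X z\<^esub> s z) \<oplus>\<^bsub>?R\<^esub> s = \<zero>\<^bsub>?R\<^esub>"
        using s by (intro eqI) (simp_all add: closed eval stalk simprules(9))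
    qed
    show "\<zero>\<^bsub>?R\<^esub> \<oplus>\<^bsub>?R\<^esub> s = s"
      by (intro eqI closed s) (simp_all add: eval stalk s simprules(8))
    show "\<one>\<^bsub>?R\<^esub> \<otimes>\<^bsub>?R\<^esub> s = s"
      by (intro eqI closed s) (simp_all add: eval stalk s simprules(12))
    fix t assume t: "t \<in> carrier ?R"
    show "s \<oplus>\<^bsub>?R\<^esub> t = t \<oplus>\<^bsub>?R\<^esub> s"
      by (intro eqI closed s t) (simp_all add: eval stalk s t simprules(10))
    show "s \<otimes>\<^bsub>?R\<^esub> t = t \<otimes>\<^bsub>?R\<^esub> s"
      by (intro eqI closed s t) (simp_all add: eval stalk s t simprules(14))
    fix u assume u: "u \<in> carrier ?R"
    show "s \<oplus>\<^bsub>?R\<^esub> t \<oplus>\<^bsub>?R\<^esub> u = s \<oplus>\<^bsub>?R\<^esub> (t \<oplus>\<^bsub>?R\<^esub> u)"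
      by (intro eqI closed s t u) (simp_all add: eval stalk s t u simprules(7))
    show "s \<otimes>\<^bsub>?R\<^esub> t \<otimes>\<^bsub>?R\<^esub> u = s \<otimes>\<^bsub>?R\<^esub> (t \<otimes>\<^bsub>?R\<^esub> u)"
      by (intro eqI closed s t u) (simp_all add: eval stalk s t u simprules(11))
    show "(s \<oplus>\<^bsub>?R\<^esub> t) \<otimes>\<^bsub>?R\<^esub> u = s \<otimes>\<^bsub>?R\<^esub> u \<oplus>\<^bsub>?R\<^esub> t \<otimes>\<^bsub>?R\<^esub> u"
      by (intro eqI closed s t u) (simp_all add: eval stalk s t u simprules(13))
  qed (auto simp: R add mult zero one)
qed

text \<open>Restriction of sections is restriction of functions, which settles functoriality and
  locality at once. The work lies in gluing, where compatibility must hold between points of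
  different members of the cover.\<close>

lemma ringed_finite_space_rs_subspace:
  assumes Z: "Z \<subseteq> points X"
  shows "ringed_finite_space (rs_subspace X Z)"
proof (intro ringed_finite_space.intro ringed_space.intro ringed_finite_space_axioms.intro)
  have sub: "V \<subseteq> points X" if "openin (top_of (rs_subspace X Z)) V" for V
    using openin_subset[OF that] Z by (auto simp: points_rs_subspace)
  show "finite (points (rs_subspace X Z))"
    using finite_subset[OF Z finite_points] by (simp add: points_rs_subspace[OF Z])
  show "cring (sections (rs_subspace X Z) U)" if "openin (top_of (rs_subspace X Z)) U" for U
    by (rule cring_rs_subspace_sections[OF sub[OF that]])
  show "restr (rs_subspace X Z) U V \<in> ring_hom (sections (rs_subspace X Z) U) (sections (rs_subspace X Z) V)"
    if "openin (top_of (rs_subspace X Z)) U" "openin (top_of (rs_subspace X Z)) V" "V \<subseteq> U" for U V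
  proof (rule ring_hom_memI)
    fix s assume "s \<in> carrier (sections (rs_subspace X Z) U)"
    then show "restr (rs_subspace X Z) U V s \<in> carrier (sections (rs_subspace X Z) V)"
      using sub_sections_restrict[OF sub[OF that(1)] that(3)] by (simp add: rs_subspace_simps)
  qed (use that(3) in \<open>auto simp: rs_subspace_simps fun_eq_iff\<close>)
  show "restr (rs_subspace X Z) U U s = s" if "s \<in> carrier (sections (rs_subspace X Z) U)" for U s
    using that by (simp add: rs_subspace_simps sub_sections_extensional extensional_restrict)
  show "restr (rs_subspace X Z) V W (restr (rs_subspace X Z) U V s) = restr (rs_subspace X Z) U W s"
    if "W \<subseteq> V" for U V W s
    using that by (simp add: rs_subspace_simps Int_absorb1)
  show "s = t"
    if "s \<in> carrier (sections (rs_subspace X Z) (\<Union>\<V>))" "t \<in> carrier (sections (rs_subspace X Z) (\<Union>\<V>))"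
      and eq: "\<And>V. V \<in> \<V> \<Longrightarrow> restr (rs_subspace X Z) (\<Union>\<V>) V s = restr (rs_subspace X Z) (\<Union>\<V>) V t"
    for \<V> s t
  proof (rule extensionalityI[of _ "\<Union>\<V>"])
    show "s \<in> extensional (\<Union>\<V>)" "t \<in> extensional (\<Union>\<V>)"
      using that(1,2) by (simp_all add: rs_subspace_simps sub_sections_extensional)
    fix z assume "z \<in> \<Union>\<V>"
    then obtain V where "V \<in> \<V>" "z \<in> V" by blast
    then show "s z = t z"
      using fun_cong[OF eq[of V], of z] by (simp add: rs_subspace_simps)
  qed
  show "\<exists>s \<in> carrier (sections (rs_subspace X Z) (\<Union>\<V>)). \<forall>V \<in> \<V>. restr (rs_subspace X Z) (\<Union>\<V>) V s = \<sigma> V"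
    if op: "\<And>V. V \<in> \<V> \<Longrightarrow> openin (top_of (rs_subspace X Z)) V"
      and \<sigma>: "\<And>V. V \<in> \<V> \<Longrightarrow> \<sigma> V \<in> carrier (sections (rs_subspace X Z) V)"
      and glue: "\<And>V W. V \<in> \<V> \<Longrightarrow> W \<in> \<V> \<Longrightarrow>
        restr (rs_subspace X Z) V (V \<inter> W) (\<sigma> V) = restr (rs_subspace X Z) W (V \<inter> W) (\<sigma> W)"
    for \<V> \<sigma>
  proof
    \<comment> \<open>The choice of the cover member is immaterial because the given sections agree
      on overlaps.\<close>
    define s where "s = (\<lambda>z\<in>\<Union>\<V>. \<sigma> (SOME V. V \<in> \<V> \<and> z \<in> V) z)"
    have \<sigma>': "\<sigma> V \<in> sub_sections X V" if "V \<in> \<V>" for V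
      using \<sigma>[OF that] by (simp add: rs_subspace_simps)
    have s: "s z = \<sigma> V z" if V: "V \<in> \<V>" "z \<in> V" for V z
    proof -
      let ?W = "SOME V. V \<in> \<V> \<and> z \<in> V"
      have W: "?W \<in> \<V> \<and> z \<in> ?W" by (rule someI[of _ V]) (use V in simp)
      then have "\<sigma> V z = \<sigma> ?W z"
        using fun_cong[OF glue[OF V(1), of ?W], of z] V by (simp add: rs_subspace_simps)
      then show ?thesis using V by (auto simp: s_def)
    qed
    show "s \<in> carrier (sections (rs_subspace X Z) (\<Union>\<V>))"
      unfolding rs_subspace_simps
    proof (rule sub_sectionsI)
      show "\<Union>\<V> \<subseteq> points X" using sub op by blast
      show "s \<in> extensional (\<Union>\<V>)" by (simp add: s_def)
      show "s z \<in> carrier (stalk X z)" if "z \<in> \<Union>\<V>" for z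
        using that s sub_sections_closed[OF \<sigma>'] by auto
      fix z y assume "z \<in> \<Union>\<V>" "y \<in> \<Union>\<V>" and le: "point_le X z y"
      then obtain V W where V: "V \<in> \<V>" "z \<in> V" and W: "W \<in> \<V>" "y \<in> W" by blast
      \<comment> \<open>An open set of the subspace that contains \<open>z\<close> also contains
        \<open>y\<close>, so both values can be read off from the single section
        \<open>\<sigma> V\<close>.\<close>
      have "z \<in> Z" "y \<in> Z"
        using openin_subset[OF op[OF V(1)]] openin_subset[OF op[OF W(1)]] V W
        by (auto simp: points_rs_subspace[OF Z])
      then have "point_le (rs_subspace X Z) z y"
        using le by (simp add: point_le_rs_subspace_iff[OF Z])
      then have "y \<in> V"
        using op[OF V(1)] V(2) by (simp add: point_le_iff)
      then show "stalk_restr X z y (s z) = s y"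
        using s V le sub_sections_compat[OF sub[OF op[OF V(1)]] \<sigma>'[OF V(1)]] by simp
    qed
    show "\<forall>V \<in> \<V>. restr (rs_subspace X Z) (\<Union>\<V>) V s = \<sigma> V"
    proof
      fix V assume V: "V \<in> \<V>"
      then show "restr (rs_subspace X Z) (\<Union>\<V>) V s = \<sigma> V"
        using s sub_sections_extensional[OF \<sigma>'[OF V]]
        by (intro extensionalityI[of _ V]) (auto simp: rs_subspace_simps)
    qed
  qed
qed

section \<open>Stalks of a subspace and the inclusion morphism\<close>

context
  fixes Z assumes Z: "Z \<subseteq> points X"
begin

lemma min_open_rs_subspace_points: "z \<in> Z \<Longrightarrow> min_open (rs_subspace X Z) z \<subseteq> points X"
  using Z by (auto simp: min_open_rs_subspace)

lemma mem_min_open_rs_subspaceD: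
  "z \<in> Z \<Longrightarrow> y \<in> min_open (rs_subspace X Z) z \<Longrightarrow> point_le X z y"
  using Z by (auto simp: min_open_rs_subspace point_le_def)

lemma self_mem_min_open_rs_subspace: "z \<in> Z \<Longrightarrow> z \<in> min_open (rs_subspace X Z) z"
  using Z mem_min_open by (auto simp: min_open_rs_subspace)

lemma rs_subspace_eval_hom:
  assumes "z \<in> Z"
  shows "(\<lambda>s. s z) \<in> ring_hom (stalk (rs_subspace X Z) z) (stalk X z)"
  using self_mem_min_open_rs_subspace[OF assms]
  by (intro ring_hom_memI) (auto simp: stalk_def rs_subspace_simps
    intro: sub_sections_closed[unfolded stalk_def])

lemma rs_inclusion_closed:
  assumes z: "z \<in> Z" and t: "t \<in> carrier (stalk X z)"
  shows "comor (rs_inclusion X Z) z t \<in> carrier (stalk (rs_subspace X Z) z)"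
  unfolding carrier_stalk_rs_subspace rs_inclusion_simps
  using mem_min_open_rs_subspaceD[OF z] t
  by (intro sub_sectionsI min_open_rs_subspace_points z)
    (simp_all add: stalk_restr_closed stalk_restr_stalk_restr)

text \<open>A compatible family over the minimal neighbourhood of \<open>z\<close> is determined by
  its value at the least point \<open>z\<close>. With \<open>eval_rs_inclusion\<close>, evaluation
  at \<open>z\<close> is inverse to the comorphism of the inclusion, so the subspace has the stalks
  of \<open>X\<close>.\<close>

lemma rs_inclusion_eval:
  assumes z: "z \<in> Z" and s: "s \<in> carrier (stalk (rs_subspace X Z) z)"
  shows "comor (rs_inclusion X Z) z (s z) = s"
proof -
  have s: "s \<in> sub_sections X (min_open (rs_subspace X Z) z)"
    using s by (simp add: carrier_stalk_rs_subspace)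
  show ?thesis
    by (rule extensionalityI[OF _ sub_sections_extensional[OF s]])
      (simp_all add: rs_inclusion_simps self_mem_min_open_rs_subspace[OF z]
        sub_sections_compat[OF min_open_rs_subspace_points[OF z] s] mem_min_open_rs_subspaceD[OF z])
qed

lemma eval_rs_inclusion:
  "z \<in> Z \<Longrightarrow> t \<in> carrier (stalk X z) \<Longrightarrow> comor (rs_inclusion X Z) z t z = t"
  using Z by (auto simp: rs_inclusion_simps self_mem_min_open_rs_subspace stalk_restr_refl)

text \<open>Under evaluation the stalk restrictions of the subspace become those of
  \<open>X\<close>.\<close>

lemma eval_stalk_restr:
  assumes "z \<in> Z" "y \<in> Z" "point_le X z y" "s \<in> carrier (stalk (rs_subspace X Z) z)"
  shows "stalk_restr (rs_subspace X Z) z y s y = stalk_restr X z y (s z)"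
proof -
  have y: "y \<in> min_open (rs_subspace X Z) z"
    using assms by (auto simp: min_open_rs_subspace[OF Z] point_le_def)
  have s: "s \<in> sub_sections X (min_open (rs_subspace X Z) z)"
    using assms by (simp add: carrier_stalk_rs_subspace)
  from sub_sections_compat[OF min_open_rs_subspace_points s
    self_mem_min_open_rs_subspace y assms(3)] assms(1,2)
  show ?thesis
    by (simp add: stalk_restr_def[of "rs_subspace X Z"] rs_subspace_simps self_mem_min_open_rs_subspace)
qed

lemma rs_morphism_inclusion: "rs_morphism (rs_subspace X Z) X (rs_inclusion X Z)"
  unfolding rs_morphism_def points_rs_subspace[OF Z]
proof (intro conjI ballI allI impI)
  show "continuous_map (top_of (rs_subspace X Z)) (top_of X) (pt (rs_inclusion X Z))"
    by (simp add: rs_subspace_simps rs_inclusion_simps[abs_def])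
next
  fix z assume z: "z \<in> Z"
  note hom = stalk_restr_hom[OF mem_min_open_rs_subspaceD[OF z]]
  show "comor (rs_inclusion X Z) z \<in> ring_hom (stalk X (pt (rs_inclusion X Z) z)) (stalk (rs_subspace X Z) z)"
    unfolding rs_inclusion_simps(1)
    by (rule ring_hom_memI)
      (auto simp: rs_inclusion_closed z, auto simp: rs_inclusion_simps stalk_def[of "rs_subspace X Z"]
        rs_subspace_simps fun_eq_iff ring_hom_add[OF hom] ring_hom_mult[OF hom] ring_hom_one[OF hom])
next
  fix z z' t assume le: "point_le (rs_subspace X Z) z z'"
    and "t \<in> carrier (stalk X (pt (rs_inclusion X Z) z))"
  then have t: "t \<in> carrier (stalk X z)" by (simp add: rs_inclusion_simps)
  have z: "z \<in> Z" "z' \<in> Z" "point_le X z z'"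
    using le by (simp_all add: point_le_rs_subspace_iff[OF Z])
  show "stalk_restr (rs_subspace X Z) z z' (comor (rs_inclusion X Z) z t) =
      comor (rs_inclusion X Z) z' (stalk_restr X (pt (rs_inclusion X Z) z) (pt (rs_inclusion X Z) z') t)"
    using point_le_min_open_subset[OF le] t z mem_min_open_rs_subspaceD[OF z(2)]
    by (auto simp: rs_inclusion_simps stalk_restr_def[of "rs_subspace X Z"] rs_subspace_simps
        fun_eq_iff stalk_restr_stalk_restr)
qed

end

end

section \<open>Existence and uniqueness of cores\<close>

lemma strong_deformation_retract_homotopy_equivalent:
  assumes X: "ringed_finite_space X" and Z: "strong_deformation_retract X Z"
  shows "rs_homotopy_equivalent (rs_subspace X Z) X"
proof -
  interpret ringed_finite_space X by fact
  obtain r where sub: "Z \<subseteq> points X" and r: "rs_morphism X (rs_subspace X Z) r"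
    and eq: "rs_map_eq (rs_subspace X Z) (rs_subspace X Z) (rs_comp r (rs_inclusion X Z)) rs_id"
    and hom: "rs_homotopic_with
      (\<lambda>f. rs_map_eq (rs_subspace X Z) X (rs_comp f (rs_inclusion X Z)) (rs_inclusion X Z))
      X X (rs_comp (rs_inclusion X Z) r) rs_id"
    using Z unfolding strong_deformation_retract_def by blast
  note incl = rs_morphism_inclusion[OF sub]
  have "rs_homotopic (rs_subspace X Z) (rs_subspace X Z) (rs_comp r (rs_inclusion X Z)) rs_id"
    by (rule rs_homotopic_if_eq[OF ringed_finite_space_rs_subspace[OF sub]
          rs_morphism_comp[OF incl r] rs_morphism_id eq])
  moreover have "rs_homotopic X X (rs_comp (rs_inclusion X Z) r) rs_id"
    unfolding rs_homotopic_def by (rule rs_homotopic_with_mono[OF hom]) simp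
  ultimately show ?thesis
    unfolding rs_homotopy_equivalent_def rs_homotopy_equivalence_def using incl r by blast
qed

text \<open>A form of the condition that a homotopy be relative to \<open>Z\<close> which speaks of
  stalks of \<open>X\<close> only and avoids families of germs.\<close>

definition fixes_stalks ::
  "('a, 'r) ringed_space_data \<Rightarrow> 'a set \<Rightarrow> ('a, 'r, 'a, 'r) rs_map \<Rightarrow> bool"
where
  "fixes_stalks X Z f \<longleftrightarrow>
     (\<forall>z \<in> Z. pt f z = z \<and> (\<forall>s \<in> carrier (stalk X z). comor f z s = s))"

lemma fixes_stalksD:
  "fixes_stalks X Z f \<Longrightarrow> z \<in> Z \<Longrightarrow> pt f z = z"
  "fixes_stalks X Z f \<Longrightarrow> z \<in> Z \<Longrightarrow> s \<in> carrier (stalk X z) \<Longrightarrow> comor f z s = s"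
  by (simp_all add: fixes_stalks_def)

text \<open>
  Beat points are removed by modifying endomorphisms of the fixed space \<open>X\<close>, because a subspace of a
  subspace has sections of yet another type.
\<close>

definition retracting_endomorphism ::
  "('a, 'r) ringed_space_data \<Rightarrow> 'a set \<Rightarrow> ('a, 'r, 'a, 'r) rs_map \<Rightarrow> bool"
where
  "retracting_endomorphism X Z f \<longleftrightarrow> Z \<subseteq> points X \<and> (\<forall>p \<in> points X. pt f p \<in> Z) \<and>
     rs_homotopic_with (fixes_stalks X Z) X X f rs_id"

lemma retracting_endomorphismD:
  assumes "retracting_endomorphism X Z f"
  shows "Z \<subseteq> points X" "rs_morphism X X f" "fixes_stalks X Z f"
    "p \<in> points X \<Longrightarrow> pt f p \<in> Z"
  using assms by (simp_all add: retracting_endomorphism_def rs_homotopic_with_iff)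

context ringed_finite_space
begin

lemma strong_deformation_retract_if_retracting_endomorphism:
  assumes f: "retracting_endomorphism X Z f"
  shows "strong_deformation_retract X Z"
proof -
  note Z = retracting_endomorphismD(1)[OF f]
    and mor = retracting_endomorphismD(2)[OF f]
    and fixed = fixes_stalksD[OF retracting_endomorphismD(3)[OF f]]
    and fZ = retracting_endomorphismD(4)[OF f]
  note self = self_mem_min_open_rs_subspace[OF Z]
  \<comment> \<open>A section of the subspace near \<open>pt f p\<close> is a family of germs; it is
    evaluated at \<open>pt f p\<close> before the comorphism of \<open>f\<close> applies.\<close>
  define r :: "('a, 'r, 'a, 'a \<Rightarrow> 'r) rs_map"
    where "r = \<lparr>pt = pt f, comor = \<lambda>p s. comor f p (s (pt f p))\<rparr>"
  have r_simps: "pt r p = pt f p" "comor r p s = comor f p (s (pt f p))" for p s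
    by (simp_all add: r_def)
  have eval: "s z \<in> carrier (stalk X z)" if "z \<in> Z" "s \<in> carrier (stalk (rs_subspace X Z) z)" for s z
    by (rule ring_hom_closed[OF rs_subspace_eval_hom[OF Z that(1)] that(2)])
  have r: "rs_morphism X (rs_subspace X Z) r"
    unfolding rs_morphism_def
  proof (intro conjI ballI allI impI)
    show "continuous_map (top_of X) (top_of (rs_subspace X Z)) (pt r)"
      using mor fZ by (auto simp: rs_subspace_simps r_def continuous_map_in_subtopology rs_morphism_def)
  next
    fix p assume p: "p \<in> points X"
    have "comor f p \<circ> (\<lambda>s. s (pt f p)) \<in> ring_hom (stalk (rs_subspace X Z) (pt f p)) (stalk X p)"
      by (rule ring_hom_trans[OF rs_subspace_eval_hom[OF Z fZ[OF p]] rs_morphism_hom[OF mor p]])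
    then show "comor r p \<in> ring_hom (stalk (rs_subspace X Z) (pt r p)) (stalk X p)"
      by (simp add: r_def o_def)
  next
    fix p q s assume le: "point_le X p q" and s: "s \<in> carrier (stalk (rs_subspace X Z) (pt r p))"
    note p = fZ[OF point_le_points(1)[OF le]] and q = fZ[OF point_le_points(2)[OF le]]
    show "stalk_restr X p q (comor r p s) =
        comor r q (stalk_restr (rs_subspace X Z) (pt r p) (pt r q) s)"
      using s eval[OF p] by (simp add: r_simps rs_morphism_compat[OF mor le]
          eval_stalk_restr[OF Z p q rs_morphism_point_le[OF mor le]])
  qed
  have ri: "rs_map_eq (rs_subspace X Z) (rs_subspace X Z) (rs_comp r (rs_inclusion X Z)) rs_id"
    unfolding rs_map_eq_def points_rs_subspace[OF Z]
  proof (intro ballI conjI)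
    fix z assume z: "z \<in> Z"
    then show "pt (rs_comp r (rs_inclusion X Z)) z = pt rs_id z"
      by (simp add: r_simps rs_inclusion_simps(1) fixed)
    fix s assume "s \<in> carrier (stalk (rs_subspace X Z) (pt (rs_comp r (rs_inclusion X Z)) z))"
    then have "s \<in> carrier (stalk (rs_subspace X Z) z)"
      using z by (simp add: r_simps rs_inclusion_simps(1) fixed)
    then show "comor (rs_comp r (rs_inclusion X Z)) z s = comor rs_id z s"
      using z eval[OF z] by (simp add: r_simps rs_inclusion_simps(1) fixed rs_inclusion_eval[OF Z])
  qed
  have ir: "rs_map_eq X X (rs_comp (rs_inclusion X Z) r) f"
    unfolding rs_map_eq_def
    by (simp add: r_simps rs_inclusion_simps(1) eval_rs_inclusion[OF Z] fZ)
  have rel: "rs_map_eq (rs_subspace X Z) X (rs_comp h (rs_inclusion X Z)) (rs_inclusion X Z)"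
    if "fixes_stalks X Z h" for h
    unfolding rs_map_eq_def points_rs_subspace[OF Z]
    by (simp add: rs_inclusion_simps(1) fixes_stalksD[OF that])
  let ?P = "\<lambda>f. rs_map_eq (rs_subspace X Z) X (rs_comp f (rs_inclusion X Z)) (rs_inclusion X Z)"
  have ir_mor: "rs_morphism X X (rs_comp (rs_inclusion X Z) r)"
    by (rule rs_morphism_comp[OF r rs_morphism_inclusion[OF Z]])
  have "?P (rs_comp (rs_inclusion X Z) r)"
    unfolding rs_map_eq_def points_rs_subspace[OF Z]
    by (simp add: r_simps rs_inclusion_simps(1) fixed eval_rs_inclusion[OF Z])
  \<comment> \<open>The composite of \<open>r\<close> with the inclusion represents the morphism
    \<open>f\<close>, but the two may differ off the carriers; one link bridges this.\<close>
  then have "homotopy_step ?P X X (rs_comp (rs_inclusion X Z) r) f"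
    unfolding homotopy_step_def
    using ir_mor mor rel[OF retracting_endomorphismD(3)[OF f]]
      rs_map_le_if_eq[OF ringed_finite_space_axioms ir_mor ir] by simp
  moreover have "rs_homotopic_with ?P X X f rs_id"
    using f unfolding retracting_endomorphism_def by (auto elim!: rs_homotopic_with_mono intro: rel)
  ultimately have "rs_homotopic_with ?P X X (rs_comp (rs_inclusion X Z) r) rs_id"
    using rs_homotopic_with_trans[OF rs_homotopic_with_step] by blast
  then show ?thesis
    unfolding strong_deformation_retract_def using Z r ri by blast
qed

end

text \<open>Compatibility holds because restricting from \<open>g p\<close> to \<open>pt f q\<close>
  gives the same result through \<open>pt f p\<close> and through \<open>g q\<close>.\<close>

lemma lower_morphism:
  assumes X: "ringed_finite_space X" and Y: "ringed_finite_space Y" and f: "rs_morphism X Y f"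
    and mono: "\<And>p q. point_le X p q \<Longrightarrow> point_le Y (g p) (g q)"
    and le: "\<And>p. p \<in> points X \<Longrightarrow> point_le Y (g p) (pt f p)"
    and f': "f' = \<lparr>pt = g, comor = \<lambda>p s. comor f p (stalk_restr Y (g p) (pt f p) s)\<rparr>"
  shows "rs_morphism X Y f'" "rs_map_le X Y f' f"
proof -
  interpret X: ringed_finite_space X by fact
  interpret Y: ringed_finite_space Y by fact
  have f'_simps: "pt f' p = g p" "comor f' p s = comor f p (stalk_restr Y (g p) (pt f p) s)" for p s
    by (simp_all add: f')
  show "rs_map_le X Y f' f"
    by (rule rs_map_leI) (simp_all add: f'_simps le)
  show "rs_morphism X Y f'"
    unfolding rs_morphism_def
  proof (intro conjI ballI allI impI)
    show "continuous_map (top_of X) (top_of Y) (pt f')"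
      unfolding f' by (simp add: X.continuous_map_if_mono[OF mono])
  next
    fix p assume p: "p \<in> points X"
    have "comor f p \<circ> stalk_restr Y (g p) (pt f p) \<in> ring_hom (stalk Y (g p)) (stalk X p)"
      by (rule ring_hom_trans[OF Y.stalk_restr_hom[OF le[OF p]] rs_morphism_hom[OF f p]])
    then show "comor f' p \<in> ring_hom (stalk Y (pt f' p)) (stalk X p)"
      by (simp add: f' o_def)
  next
    fix p q s assume pq: "point_le X p q" and "s \<in> carrier (stalk Y (pt f' p))"
    then have s: "s \<in> carrier (stalk Y (g p))" by (simp add: f'_simps)
    note p = point_le_points(1)[OF pq] and q = point_le_points(2)[OF pq]
    show "stalk_restr X p q (comor f' p s) = comor f' q (stalk_restr Y (pt f' p) (pt f' q) s)"
      using s by (simp add: f'_simps rs_morphism_compat[OF f pq] Y.stalk_restr_closed[OF le[OF p]]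
        Y.stalk_restr_stalk_restr[OF le[OF p] rs_morphism_point_le[OF f pq]]
        Y.stalk_restr_stalk_restr[OF mono[OF pq] le[OF q]])
  qed
qed

text \<open>The desired comparison forces the comorphism of \<open>f\<close> to factor through the
  restriction from \<open>pt f p\<close> to \<open>g p\<close>, so the new comorphism is built with
  its inverse.\<close>

lemma raise_morphism:
  assumes X: "ringed_finite_space X" and Y: "ringed_finite_space Y" and f: "rs_morphism X Y f"
    and mono: "\<And>p q. point_le X p q \<Longrightarrow> point_le Y (g p) (g q)"
    and le: "\<And>p. p \<in> points X \<Longrightarrow> point_le Y (pt f p) (g p)"
    and iso: "\<And>p. p \<in> points X \<Longrightarrow>
      stalk_restr Y (pt f p) (g p) \<in> ring_iso (stalk Y (pt f p)) (stalk Y (g p))"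
    and f': "f' = \<lparr>pt = g, comor = \<lambda>p s.
      comor f p (inv_into (carrier (stalk Y (pt f p))) (stalk_restr Y (pt f p) (g p)) s)\<rparr>"
  shows "rs_morphism X Y f'" "rs_map_le X Y f f'"
proof -
  interpret X: ringed_finite_space X by fact
  interpret Y: ringed_finite_space Y by fact
  define e where "e p = inv_into (carrier (stalk Y (pt f p))) (stalk_restr Y (pt f p) (g p))" for p
  have f'_simps: "pt f' p = g p" "comor f' p s = comor f p (e p s)" for p s
    by (simp_all add: f' e_def)
  have bij: "bij_betw (stalk_restr Y (pt f p) (g p)) (carrier (stalk Y (pt f p))) (carrier (stalk Y (g p)))"
    if "p \<in> points X" for p
    using iso[OF that] by (simp add: ring_iso_def)
  have e_left: "e p (stalk_restr Y (pt f p) (g p) s) = s"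
    if "p \<in> points X" "s \<in> carrier (stalk Y (pt f p))" for p s
    unfolding e_def by (rule bij_betw_inv_into_left[OF bij[OF that(1)] that(2)])
  have e_right: "stalk_restr Y (pt f p) (g p) (e p s) = s"
    if "p \<in> points X" "s \<in> carrier (stalk Y (g p))" for p s
    unfolding e_def by (rule bij_betw_inv_into_right[OF bij[OF that(1)] that(2)])
  have e_hom: "e p \<in> ring_hom (stalk Y (g p)) (stalk Y (pt f p))" if p: "p \<in> points X" for p
    using ring_iso_set_sym[OF cring.axioms(1)[OF Y.cring_stalk[OF rs_morphism_points[OF f p]]] iso[OF p]]
    by (simp add: e_def ring_iso_def)
  show "rs_map_le X Y f f'"
    by (rule rs_map_leI) (simp_all add: f'_simps le e_left)
  show "rs_morphism X Y f'"
    unfolding rs_morphism_def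
  proof (intro conjI ballI allI impI)
    show "continuous_map (top_of X) (top_of Y) (pt f')"
      unfolding f' by (simp add: X.continuous_map_if_mono[OF mono])
  next
    fix p assume p: "p \<in> points X"
    have "comor f p \<circ> e p \<in> ring_hom (stalk Y (g p)) (stalk X p)"
      by (rule ring_hom_trans[OF e_hom[OF p] rs_morphism_hom[OF f p]])
    then show "comor f' p \<in> ring_hom (stalk Y (pt f' p)) (stalk X p)"
      by (simp add: f' e_def o_def)
  next
    fix p q s assume pq: "point_le X p q" and "s \<in> carrier (stalk Y (pt f' p))"
    then have s: "s \<in> carrier (stalk Y (g p))" by (simp add: f'_simps)
    note p = point_le_points(1)[OF pq] and q = point_le_points(2)[OF pq]
    note fpq = rs_morphism_point_le[OF f pq]
    have es: "e p s \<in> carrier (stalk Y (pt f p))"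
      by (rule ring_hom_closed[OF e_hom[OF p] s])
    \<comment> \<open>Both sides are the restriction of \<open>e p s\<close> from
      \<open>pt f p\<close> to \<open>g q\<close>. Cancelling the isomorphism at \<open>q\<close>
      shows that the inverses commute with restriction.\<close>
    have "stalk_restr Y (pt f q) (g q) (stalk_restr Y (pt f p) (pt f q) (e p s))
        = stalk_restr Y (g p) (g q) (stalk_restr Y (pt f p) (g p) (e p s))"
      by (simp add: Y.stalk_restr_stalk_restr[OF fpq le[OF q] es]
          Y.stalk_restr_stalk_restr[OF le[OF p] mono[OF pq] es])
    then have "stalk_restr Y (pt f p) (pt f q) (e p s) = e q (stalk_restr Y (g p) (g q) s)"
      using e_left[OF q Y.stalk_restr_closed[OF fpq es]] e_right[OF p s] by simp
    then show "stalk_restr X p q (comor f' p s) = comor f' q (stalk_restr Y (pt f' p) (pt f' q) s)"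
      by (simp add: f'_simps rs_morphism_compat[OF f pq es])
  qed
qed

section \<open>Removing a point from a retract\<close>

context ringed_finite_space
begin

text \<open>Every map that fixes the stalks over \<open>Z\<close> fixes those over
  \<open>Z - {p}\<close>, so the old homotopy survives and one link is put in front of it.\<close>

lemma retracting_endomorphism_remove:
  assumes f: "retracting_endomorphism X Z f"
    and f': "rs_morphism X X f'" "fixes_stalks X (Z - {p}) f'"
      "\<And>x. x \<in> points X \<Longrightarrow> pt f' x \<in> Z - {p}"
    and le: "rs_map_le X X f f' \<or> rs_map_le X X f' f"
  shows "retracting_endomorphism X (Z - {p}) f'"
proof -
  have mono: "fixes_stalks X (Z - {p}) h" if "fixes_stalks X Z h" for h
    using that by (simp add: fixes_stalks_def)
  have "homotopy_step (fixes_stalks X (Z - {p})) X X f' f"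
    using f' le retracting_endomorphismD(2,3)[OF f] mono by (auto simp: homotopy_step_def)
  moreover have "rs_homotopic_with (fixes_stalks X (Z - {p})) X X f rs_id"
    using f mono unfolding retracting_endomorphism_def by (auto elim!: rs_homotopic_with_mono)
  ultimately have "rs_homotopic_with (fixes_stalks X (Z - {p})) X X f' rs_id"
    using rs_homotopic_with_trans[OF rs_homotopic_with_step] by blast
  then show ?thesis
    using f'(3) retracting_endomorphismD(1)[OF f] by (auto simp: retracting_endomorphism_def)
qed

text \<open>Values equal to \<open>p\<close> are redirected to \<open>q\<close>. The order is tested
  on \<open>Z\<close> because \<open>f\<close> takes its values there. Since \<open>p\<close> and
  \<open>q\<close> may also lie below each other, the lemma covers the merging of two points that
  violate T0.\<close>

lemma remove_down_beat_point:
  assumes f: "retracting_endomorphism X Z f"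
    and q: "p \<in> Z" "q \<in> Z" "q \<noteq> p" "point_le X q p"
    and max: "\<And>y. y \<in> Z \<Longrightarrow> y \<noteq> p \<Longrightarrow> point_le X y p \<Longrightarrow> point_le X y q"
  shows "\<exists>f'. retracting_endomorphism X (Z - {p}) f'"
proof -
  note mor = retracting_endomorphismD(2)[OF f] and fZ = retracting_endomorphismD(4)[OF f]
    and fixed = fixes_stalksD[OF retracting_endomorphismD(3)[OF f]]
    and Z = retracting_endomorphismD(1)[OF f]
  define g where "g x = (if pt f x = p then q else pt f x)" for x
  define f' where "f' = \<lparr>pt = g, comor = \<lambda>x s. comor f x (stalk_restr X (g x) (pt f x) s)\<rparr>"
  have le: "point_le X (g x) (pt f x)" if "x \<in> points X" for x
    using q(4) point_le_refl rs_morphism_points[OF mor that] by (auto simp: g_def)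
  have mono: "point_le X (g x) (g y)" if xy: "point_le X x y" for x y
  proof -
    note fxy = rs_morphism_point_le[OF mor xy]
    show ?thesis
    proof (cases "pt f y = p \<and> pt f x \<noteq> p")
      \<comment> \<open>The critical case for monotonicity: the upper value drops from
        \<open>p\<close> to \<open>q\<close> while the lower one stays, and maximality of
        \<open>q\<close> keeps them in order.\<close>
      case True
      then show ?thesis
        using max fZ[OF point_le_points(1)[OF xy]] fxy by (simp add: g_def)
    next
      case False
      then show ?thesis
        using fxy q(2,4) point_le_trans[OF q(4)] point_le_refl[OF subsetD[OF Z q(2)]] by (auto simp: g_def)
    qed
  qed
  have "rs_morphism X X f'" "rs_map_le X X f' f"
    using lower_morphism[OF ringed_finite_space_axioms ringed_finite_space_axioms mor mono le f'_def]
    by blast+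
  moreover have "fixes_stalks X (Z - {p}) f'"
    using Z by (auto simp: fixes_stalks_def f'_def g_def fixed stalk_restr_refl)
  moreover have "pt f' x \<in> Z - {p}" if "x \<in> points X" for x
    using fZ[OF that] q by (simp add: f'_def g_def)
  ultimately show ?thesis
    using retracting_endomorphism_remove[OF f] by blast
qed

lemma remove_up_beat_point:
  assumes f: "retracting_endomorphism X Z f"
    and q: "p \<in> Z" "q \<in> Z" "q \<noteq> p" "point_le X p q"
    and min: "\<And>y. y \<in> Z \<Longrightarrow> y \<noteq> p \<Longrightarrow> point_le X p y \<Longrightarrow> point_le X q y"
    and iso: "stalk_restr X p q \<in> ring_iso (stalk X p) (stalk X q)"
  shows "\<exists>f'. retracting_endomorphism X (Z - {p}) f'"
proof -
  note mor = retracting_endomorphismD(2)[OF f] and fZ = retracting_endomorphismD(4)[OF f]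
    and fixed = fixes_stalksD[OF retracting_endomorphismD(3)[OF f]]
    and Z = retracting_endomorphismD(1)[OF f]
  define g where "g x = (if pt f x = p then q else pt f x)" for x
  define f' where "f' = \<lparr>pt = g, comor = \<lambda>x s.
    comor f x (inv_into (carrier (stalk X (pt f x))) (stalk_restr X (pt f x) (g x)) s)\<rparr>"
  have le: "point_le X (pt f x) (g x)" if "x \<in> points X" for x
    using q(4) point_le_refl rs_morphism_points[OF mor that] by (auto simp: g_def)
  have g_iso: "stalk_restr X (pt f x) (g x) \<in> ring_iso (stalk X (pt f x)) (stalk X (g x))"
    if "x \<in> points X" for x
    using iso stalk_restr_refl_iso rs_morphism_points[OF mor that] by (auto simp: g_def)
  have mono: "point_le X (g x) (g y)" if xy: "point_le X x y" for x y
  proof -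
    note fxy = rs_morphism_point_le[OF mor xy]
    show ?thesis
    proof (cases "pt f x = p \<and> pt f y \<noteq> p")
      case True
      then show ?thesis
        using min fZ[OF point_le_points(2)[OF xy]] fxy by (simp add: g_def)
    next
      case False
      then show ?thesis
        using fxy q(2,4) point_le_trans[OF _ q(4)] point_le_refl[OF subsetD[OF Z q(2)]] by (auto simp: g_def)
    qed
  qed
  have "rs_morphism X X f'" "rs_map_le X X f f'"
    using raise_morphism[OF ringed_finite_space_axioms ringed_finite_space_axioms mor mono le g_iso f'_def]
    by blast+
  \<comment> \<open>At points of \<open>Z\<close> other than \<open>p\<close> nothing moves, and the
    inverted restriction is the identity, so the new comorphism is still that of
    \<open>f\<close>.\<close>
  moreover have "inv_into (carrier (stalk X z)) (stalk_restr X z z) s = s"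
    if "z \<in> points X" "s \<in> carrier (stalk X z)" for z s
    using bij_betw_inv_into_left[of "stalk_restr X z z" "carrier (stalk X z)" "carrier (stalk X z)" s]
      stalk_restr_refl_iso[OF that(1)] stalk_restr_refl[OF that] that(2)
    by (simp add: ring_iso_def)
  then have "fixes_stalks X (Z - {p}) f'"
    using Z by (auto simp: fixes_stalks_def f'_def g_def fixed)
  moreover have "pt f' x \<in> Z - {p}" if "x \<in> points X" for x
    using fZ[OF that] q by (simp add: f'_def g_def)
  ultimately show ?thesis
    using retracting_endomorphism_remove[OF f] by blast
qed

text \<open>An up beat point of the subspace supplies an isomorphism between stalks of the subspace.
  Composing it with the inclusion comorphism at \<open>p\<close> and evaluation at \<open>q\<close>
  yields the restriction in \<open>X\<close>, as needed for removing the point.\<close>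

lemma ring_iso_stalk_restr_rs_subspaceD:
  assumes Z: "Z \<subseteq> points X" and pq: "p \<in> Z" "q \<in> Z" "point_le X p q"
    and iso: "stalk_restr (rs_subspace X Z) p q
      \<in> ring_iso (stalk (rs_subspace X Z) p) (stalk (rs_subspace X Z) q)"
  shows "stalk_restr X p q \<in> ring_iso (stalk X p) (stalk X q)"
proof -
  let ?S = "rs_subspace X Z" and ?i = "comor (rs_inclusion X Z)"
  have bij: "bij_betw (stalk_restr ?S p q) (carrier (stalk ?S p)) (carrier (stalk ?S q))"
    using iso by (simp add: ring_iso_def)
  have ev: "bij_betw (\<lambda>s. s z) (carrier (stalk ?S z)) (carrier (stalk X z))"
    and incl: "bij_betw (?i z) (carrier (stalk X z)) (carrier (stalk ?S z))" if z: "z \<in> Z" for z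
  proof -
    have "(\<lambda>s. s z) ` carrier (stalk ?S z) \<subseteq> carrier (stalk X z)"
      using ring_hom_closed[OF rs_subspace_eval_hom[OF Z z]] by blast
    moreover have "?i z ` carrier (stalk X z) \<subseteq> carrier (stalk ?S z)"
      using rs_inclusion_closed[OF Z z] by blast
    ultimately show "bij_betw (\<lambda>s. s z) (carrier (stalk ?S z)) (carrier (stalk X z))"
      "bij_betw (?i z) (carrier (stalk X z)) (carrier (stalk ?S z))"
      by (auto intro!: bij_betw_byWitness[where f' = "?i z"] bij_betw_byWitness[where f' = "\<lambda>s. s z"]
          simp: rs_inclusion_eval[OF Z z] eval_rs_inclusion[OF Z z])
  qed
  have "bij_betw ((\<lambda>s. s q) \<circ> (stalk_restr ?S p q \<circ> ?i p)) (carrier (stalk X p)) (carrier (stalk X q))"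
    by (rule bij_betw_trans[OF bij_betw_trans[OF incl[OF pq(1)] bij] ev[OF pq(2)]])
  moreover have "((\<lambda>s. s q) \<circ> (stalk_restr ?S p q \<circ> ?i p)) t = stalk_restr X p q t"
    if "t \<in> carrier (stalk X p)" for t
    using eval_stalk_restr[OF Z pq rs_inclusion_closed[OF Z pq(1) that]]
      eval_rs_inclusion[OF Z pq(1) that] by simp
  ultimately have "bij_betw (stalk_restr X p q) (carrier (stalk X p)) (carrier (stalk X q))"
    by (simp cong: bij_betw_cong)
  then show ?thesis
    using stalk_restr_hom[OF pq(3)] by (simp add: ring_iso_def)
qed

lemma core_exists: "\<exists>Z. is_core X Z"
proof -
  have "retracting_endomorphism X (points X) rs_id"
    by (simp add: retracting_endomorphism_def rs_homotopic_with_iff rs_morphism_id fixes_stalks_def)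
  then obtain Z where ex: "\<exists>f. retracting_endomorphism X Z f"
    and least: "\<And>W. \<exists>f. retracting_endomorphism X W f \<Longrightarrow> card Z \<le> card W"
    using ex_has_least_nat[of "\<lambda>Z. \<exists>f. retracting_endomorphism X Z f" _ card] by blast
  from ex obtain f where f: "retracting_endomorphism X Z f" by blast
  note Z = retracting_endomorphismD(1)[OF f]
  let ?S = "rs_subspace X Z"
  have irred: "\<not> (\<exists>f'. retracting_endomorphism X (Z - {p}) f')" if "p \<in> Z" for p
    using least[of "Z - {p}"] card_Diff1_less[OF finite_subset[OF Z finite_points] that] by auto
  note le_iff = point_le_rs_subspace_iff[OF Z] and points = points_rs_subspace[OF Z]
  have "t0_space (top_of ?S)"
    unfolding t0_space_iff_point_le_antisym le_iff
  proof (intro allI impI)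
    fix p q assume pq: "p \<in> Z \<and> q \<in> Z \<and> point_le X p q" "q \<in> Z \<and> p \<in> Z \<and> point_le X q p"
    show "p = q"
    proof (rule ccontr)
      assume "p \<noteq> q"
      \<comment> \<open>Everything below \<open>p\<close> is below \<open>q\<close> through
        \<open>p \<le> q\<close>, so \<open>q\<close> satisfies the maximality condition for
        removing \<open>p\<close>.\<close>
      then show False
        using irred remove_down_beat_point[OF f, of p q] pq point_le_trans[of X _ p q] by blast
    qed
  qed
  moreover have "\<not> beat_point ?S p" if "p \<in> points ?S" for p
  proof
    have p: "p \<in> Z" using that by (simp add: points)
    assume "beat_point ?S p"
    then show False
      unfolding beat_point_def
    proof
      assume "down_beat_point ?S p"
      moreover have "top_of ?S closure_of {p} - {p} = {y. point_le ?S y p \<and> y \<noteq> p}"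
        using mem_closure_of_singleton_iff[OF that] by blast
      ultimately obtain q where "point_le ?S q p" "q \<noteq> p"
        and max: "\<And>y. point_le ?S y p \<Longrightarrow> y \<noteq> p \<Longrightarrow> point_le ?S y q"
        unfolding down_beat_point_def by auto
      then show False
        using irred[OF p] remove_down_beat_point[OF f p, of q] p by (auto simp: le_iff)
    next
      assume "up_beat_point ?S p"
      then obtain q where q: "q \<in> min_open ?S p - {p}"
        and min: "\<And>y. y \<in> min_open ?S p - {p} \<Longrightarrow> point_le ?S q y"
        and iso: "stalk_restr ?S p q \<in> ring_iso (stalk ?S p) (stalk ?S q)"
        unfolding up_beat_point_def by blast
      have mem: "y \<in> min_open ?S p \<longleftrightarrow> y \<in> Z \<and> point_le X p y" for y
        using le_iff[of p y] that p by (simp add: point_le_def)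
      have q': "q \<in> Z" "q \<noteq> p" "point_le X p q" using q by (auto simp: mem)
      have "point_le X q y" if "y \<in> Z" "y \<noteq> p" "point_le X p y" for y
        using min[of y] that by (simp add: mem le_iff)
      from remove_up_beat_point[OF f p q' this
          ring_iso_stalk_restr_rs_subspaceD[OF Z p q'(1,3) iso]] irred[OF p]
      show False by blast
    qed
  qed
  ultimately have "minimal_ringed_finite_space ?S"
    unfolding minimal_ringed_finite_space_def using ringed_finite_space_rs_subspace[OF Z] by simp
  then show ?thesis
    unfolding is_core_def using strong_deformation_retract_if_retracting_endomorphism[OF f] by blast
qed

end

section \<open>Comparison of cores\<close>

lemma homotopy_equivalent_minimal_isomorphic:
  assumes "minimal_ringed_finite_space X" "minimal_ringed_finite_space Y" "rs_homotopy_equivalent X Y"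
  shows "rs_isomorphic X Y"
  using assms(3) minimal_homotopy_equivalence_isomorphism[OF assms(1,2)]
  unfolding rs_homotopy_equivalent_def rs_isomorphic_def by blast

text \<open>Each core is homotopy equivalent to its space, so equivalences transfer between spaces
  and cores, and rigidity turns one between cores into an isomorphism. The case of equal spaces is
  uniqueness of the core.\<close>

lemma cores_isomorphic_iff:
  assumes X: "ringed_finite_space X" "is_core X Z" and Y: "ringed_finite_space Y" "is_core Y W"
  shows "rs_isomorphic (rs_subspace X Z) (rs_subspace Y W) \<longleftrightarrow> rs_homotopy_equivalent X Y"
proof -
  have Z: "minimal_ringed_finite_space (rs_subspace X Z)" "rs_homotopy_equivalent (rs_subspace X Z) X"
    and W: "minimal_ringed_finite_space (rs_subspace Y W)" "rs_homotopy_equivalent (rs_subspace Y W) Y"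
    using X Y by (simp_all add: is_core_def strong_deformation_retract_homotopy_equivalent)
  note Z' = rs_homotopy_equivalent_sym[OF Z(2)] and W' = rs_homotopy_equivalent_sym[OF W(2)]
  show ?thesis
  proof
    assume "rs_isomorphic (rs_subspace X Z) (rs_subspace Y W)"
    then have "rs_homotopy_equivalent (rs_subspace X Z) (rs_subspace Y W)"
      using Z(1) W(1) unfolding minimal_ringed_finite_space_def
      by (intro rs_isomorphic_imp_homotopy_equivalent) simp_all
    then show "rs_homotopy_equivalent X Y"
      by (rule rs_homotopy_equivalent_trans[OF rs_homotopy_equivalent_trans[OF Z'] W(2)])
  next
    assume "rs_homotopy_equivalent X Y"
    from rs_homotopy_equivalent_trans[OF rs_homotopy_equivalent_trans[OF Z(2) this] W']
    show "rs_isomorphic (rs_subspace X Z) (rs_subspace Y W)"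
      by (rule homotopy_equivalent_minimal_isomorphic[OF Z(1) W(1)])
  qed
qed

lemma rs_homotopy_equivalent_refl:
  assumes "ringed_finite_space X"
  shows "rs_homotopy_equivalent X X"
  unfolding rs_homotopy_equivalent_def rs_homotopy_equivalence_def rs_homotopic_def
  by (intro exI[of _ rs_id] conjI) (simp_all add: rs_morphism_id rs_homotopic_with_iff)

theorem theorem3p13:
  fixes X :: "('a, 'r) ringed_space_data" and Y :: "('b, 's) ringed_space_data"
  shows "(\<forall>f. minimal_ringed_finite_space X \<longrightarrow> minimal_ringed_finite_space Y \<longrightarrow>
             rs_homotopy_equivalence X Y f \<longrightarrow> rs_isomorphism X Y f)
       \<and> (ringed_finite_space X \<longrightarrow>
             (\<forall>Z Z'. is_core X Z \<longrightarrow> is_core X Z' \<longrightarrow>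
                rs_isomorphic (rs_subspace X Z) (rs_subspace X Z')))
       \<and> (ringed_finite_space X \<longrightarrow> ringed_finite_space Y \<longrightarrow>
             (rs_homotopy_equivalent X Y \<longleftrightarrow>
                (\<exists>Z W. is_core X Z \<and> is_core Y W \<and>
                   rs_isomorphic (rs_subspace X Z) (rs_subspace Y W))))"
proof (intro conjI allI impI)
  fix f
  assume "minimal_ringed_finite_space X" "minimal_ringed_finite_space Y"
    "rs_homotopy_equivalence X Y f"
  then show "rs_isomorphism X Y f" by (rule minimal_homotopy_equivalence_isomorphism)
next
  fix Z Z' assume X: "ringed_finite_space X" and "is_core X Z" "is_core X Z'"
  then show "rs_isomorphic (rs_subspace X Z) (rs_subspace X Z')"
    using cores_isomorphic_iff[OF X _ X] rs_homotopy_equivalent_refl[OF X] by simp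
next
  assume X: "ringed_finite_space X" and Y: "ringed_finite_space Y"
  \<comment> \<open>Existence serves the forward implication; for the converse,
    \<open>cores_isomorphic_iff\<close> applies to whichever cores are given.\<close>
  obtain Z W where "is_core X Z" "is_core Y W"
    using ringed_finite_space.core_exists[OF X] ringed_finite_space.core_exists[OF Y] by blast
  then show "rs_homotopy_equivalent X Y \<longleftrightarrow>
      (\<exists>Z W. is_core X Z \<and> is_core Y W \<and> rs_isomorphic (rs_subspace X Z) (rs_subspace Y W))"
    using cores_isomorphic_iff[OF X _ Y] by metis
qed

end
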